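(* One has $$\liminf_{L\to\infty}\omega_1(L)\ \ge\ \omega_1^*>0 .$$
   Context: For $L>0$, $\mathbb{T}_L=\mathbb{R}/(L\mathbb{Z})$. $T_r=e^{ir\partial_x^2}$ denotes the free Schrödinger propagator (on $\mathbb{T}_L$ or on $\mathbb{R}$, respectively). Define $$\omega_1(L)=\max_{\|f\|_{L^2(\mathbb{T}_L)}=1}\int_0^1\int_{\mathbb{T}_L}|T_rf|^4\,dx\,dr,\qquad \omega_1^*=\max_{\|\phi\|_{L^2(\mathbb{R})}=1}\int_0^1\int_{\mathbb{R}}|T_r\phi|^4\,dx\,dr,$$ where $\|f\|_{L^2(\mathbb{T}_L)}^2=\int_0^L|f|^2\,dx$. (It is known that the maximum on $\mathbb{R}$ is finite and attained.) *)

theory Defs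
  imports "HOL-Analysis.Analysis"
begin

text \<open>
  Elements of an \<open>L\<^sup>2\<close> space are represented by functions, with equality almost everywhere left
  implicit. Squared norms are taken in \<open>[0, \<infinity>]\<close>, so that a function that is not square integrable
  has infinite norm instead of a default value.
\<close>

definition L2_norm_sq :: "real measure \<Rightarrow> (real \<Rightarrow> complex) \<Rightarrow> ennreal" where
  "L2_norm_sq M f = (\<integral>\<^sup>+ x. ennreal ((cmod (f x))\<^sup>2) \<partial>M)"

definition L2_space :: "real measure \<Rightarrow> (real \<Rightarrow> complex) set" where
  "L2_space M = {f \<in> borel_measurable M. L2_norm_sq M f < \<infinity>}"

definition L2_tendsto ::
    "real measure \<Rightarrow> (nat \<Rightarrow> real \<Rightarrow> complex) \<Rightarrow> (real \<Rightarrow> complex) \<Rightarrow> bool" where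
  "L2_tendsto M F g \<longleftrightarrow> (\<lambda>N. L2_norm_sq M (\<lambda>x. F N x - g x)) \<longlonglongrightarrow> 0"


section \<open>The free propagator on the real line\<close>

text \<open>
  The Fourier transform on \<open>L\<^sup>2(\<real>)\<close> (angular frequency, with the factor \<open>1 / (2 \<pi>)\<close> in the inverse
  transform) is the \<open>L\<^sup>2\<close> limit of truncated Fourier integrals, which exists by Plancherel's
  theorem. The limit is determined up to a null set, and \<open>SOME\<close> picks a representative.
\<close>

definition fourier_L2 :: "(real \<Rightarrow> complex) \<Rightarrow> real \<Rightarrow> complex" where
  "fourier_L2 \<phi> = (SOME g. g \<in> L2_space lborel \<and>
     L2_tendsto lborel
       (\<lambda>N \<xi>. LINT x:{- real N..real N}|lborel. cis (- (x * \<xi>)) * \<phi> x) g)"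

definition inv_fourier_L2 :: "(real \<Rightarrow> complex) \<Rightarrow> real \<Rightarrow> complex" where
  "inv_fourier_L2 h = (SOME g. g \<in> L2_space lborel \<and>
     L2_tendsto lborel
       (\<lambda>N x. (LINT \<xi>:{- real N..real N}|lborel. cis (x * \<xi>) * h \<xi>) / of_real (2 * pi)) g)"

text \<open>\<open>\<partial>\<^sub>x\<^sup>2\<close> has Fourier symbol \<open>- \<xi>\<^sup>2\<close>, so \<open>exp (\<i> r \<partial>\<^sub>x\<^sup>2)\<close> is the multiplier \<open>cis (- r \<xi>\<^sup>2)\<close>.\<close>

definition schrodinger_line :: "real \<Rightarrow> (real \<Rightarrow> complex) \<Rightarrow> real \<Rightarrow> complex" where
  "schrodinger_line r \<phi> = inv_fourier_L2 (\<lambda>\<xi>. cis (- (r * \<xi>\<^sup>2)) * fourier_L2 \<phi> \<xi>)"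


section \<open>The free propagator on the torus\<close>

text \<open>
  Functions on \<open>\<real> / L\<int>\<close> are \<open>L\<close>-periodic functions on \<open>\<real>\<close>, integrated over the fundamental
  domain \<open>[0, L)\<close>.
\<close>

definition torus_measure :: "real \<Rightarrow> real measure" where
  "torus_measure L = restrict_space lborel {0..<L}"

definition L2_torus :: "real \<Rightarrow> (real \<Rightarrow> complex) set" where
  "L2_torus L = {f \<in> L2_space (torus_measure L). \<forall>x. f (x + L) = f x}"

definition fourier_coeff :: "real \<Rightarrow> (real \<Rightarrow> complex) \<Rightarrow> int \<Rightarrow> complex" where
  "fourier_coeff L f k =
     (LINT x|torus_measure L. cis (- (2 * pi * of_int k / L * x)) * f x) / of_real L"

definition schrodinger_torus ::
    "real \<Rightarrow> real \<Rightarrow> (real \<Rightarrow> complex) \<Rightarrow> real \<Rightarrow> complex" where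
  "schrodinger_torus L r f = (SOME g. g \<in> L2_torus L \<and>
     L2_tendsto (torus_measure L)
       (\<lambda>N x. \<Sum>k\<in>{- int N..int N}.
          cis (- (r * (2 * pi * of_int k / L)\<^sup>2)) * fourier_coeff L f k
            * cis (2 * pi * of_int k / L * x)) g)"


section \<open>The extremal constants\<close>

text \<open>
  The space-time integrals are iterated, with the spatial integral inside: its value does not
  depend on the representative of \<open>T\<^sub>r f\<close> chosen at each time, so no joint measurability of the
  representatives in \<open>(r, x)\<close> is needed. The maxima are suprema in \<open>[0, \<infinity>]\<close>.
\<close>

definition omega1 :: "real \<Rightarrow> ennreal" where
  "omega1 L = (SUP f \<in> {f \<in> L2_torus L. L2_norm_sq (torus_measure L) f = 1}.
     \<integral>\<^sup>+ r\<in>{0..1}. (\<integral>\<^sup>+ x. ennreal ((cmod (schrodinger_torus L r f x)) ^ 4) \<partial>torus_measure L) \<partial>lborel)"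

definition omega1_star :: ennreal where
  "omega1_star = (SUP \<phi> \<in> {\<phi> \<in> L2_space lborel. L2_norm_sq lborel \<phi> = 1}.
     \<integral>\<^sup>+ r\<in>{0..1}. (\<integral>\<^sup>+ x. ennreal ((cmod (schrodinger_line r \<phi> x)) ^ 4) \<partial>lborel) \<partial>lborel)"

end

theory Submission
  imports Defs "HOL-Probability.Probability"
begin

text \<open>
  No Strichartz inequality is needed. Let \<open>\<phi>\<close> be normalised on the line, with Fourier transform
  \<open>h\<close>, so \<open>\<parallel>h\<parallel>\<^sup>2 \<le> 2 \<pi>\<close>. By definition \<open>T\<^sub>r \<phi>\<close> is the \<open>L\<^sup>2\<close> limit of the waves
  \<open>u\<^sub>N r x = (2 \<pi>)\<^sup>-\<^sup>1 \<integral> h\<^sub>N \<xi> exp (\<i> x \<xi> - \<i> r \<xi>\<^sup>2) d\<xi>\<close>, where \<open>h\<^sub>N\<close> is \<open>h\<close> cut off to \<open>[-N, N]\<close>. For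
  fixed \<open>N\<close> the integrals of \<open>(2 \<pi>)\<^sup>-\<^sup>1 h\<^sub>N\<close> over the cells of the lattice \<open>(2 \<pi> / L) \<int>\<close> are the
  coefficients of a trigonometric polynomial on the torus; by Cauchy-Schwarz on each cell its norm is
  at most 1, and its free evolution, centred in the fundamental domain, converges pointwise to
  \<open>u\<^sub>N\<close> as \<open>L \<rightarrow> \<infinity>\<close>. Fatou's lemma, applied first in \<open>L\<close> and then in \<open>N\<close>, bounds the space-time
  integral of \<open>\<bar>T\<^sub>r \<phi>\<bar>\<^sup>4\<close> by the lower limit of \<open>\<omega>\<^sub>1 L\<close>. Positivity is seen on a Gaussian, whose
  evolution stays away from 0 near the space-time origin.
\<close>

section \<open>Convergence in L2\<close>

lemma L2_norm_sq_diff_commute: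
  "L2_norm_sq M (\<lambda>x. f x - g x) = L2_norm_sq M (\<lambda>x. g x - f x)"
  unfolding L2_norm_sq_def by (simp add: norm_minus_commute)

lemma L2_norm_sq_cmult:
  assumes [measurable]: "f \<in> borel_measurable M"
  shows "L2_norm_sq M (\<lambda>x. c * f x) = ennreal ((cmod c)\<^sup>2) * L2_norm_sq M f"
  unfolding L2_norm_sq_def
  by (simp add: norm_mult power_mult_distrib ennreal_mult' nn_integral_cmult)

text \<open>The weights \<open>2 ^ k\<close> still leave a convergent series: the sum of
  \<open>2 ^ k\<close> times the squared moduli has integral at most the sum of
  \<open>(1/2) ^ k\<close>, hence is finite almost everywhere. Where it has the finite value
  \<open>s\<close>, the term \<open>d k x\<close> is at most \<open>sqrt s\<close> times
  \<open>sqrt (1/2) ^ k\<close>, and a geometric comparison applies.\<close>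

lemma AE_summable_of_L2_norm_sq_le:
  assumes [measurable]: "\<And>k. d k \<in> borel_measurable M"
    and le: "\<And>k. L2_norm_sq M (d k) \<le> ennreal ((1/4) ^ k)"
  shows "AE x in M. summable (\<lambda>k. d k x)"
proof -
  let ?w = "\<lambda>k x. ennreal (2 ^ k) * ennreal ((cmod (d k x))\<^sup>2)"
  have "(\<integral>\<^sup>+ x. (\<Sum>k. ?w k x) \<partial>M) = (\<Sum>k. ennreal (2 ^ k) * L2_norm_sq M (d k))"
    by (subst nn_integral_suminf) (auto simp: nn_integral_cmult L2_norm_sq_def)
  also have "\<dots> \<le> (\<Sum>k. ennreal ((1/2) ^ k))"
  proof (intro suminf_le)
    fix k
    have "ennreal (2 ^ k) * L2_norm_sq M (d k) \<le> ennreal (2 ^ k) * ennreal ((1/4) ^ k)"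
      by (intro mult_left_mono le) simp
    also have "\<dots> = ennreal ((1/2) ^ k)"
      by (simp add: ennreal_mult'[symmetric] power_mult_distrib[symmetric])
    finally show "ennreal (2 ^ k) * L2_norm_sq M (d k) \<le> ennreal ((1/2) ^ k)" .
  qed auto
  also have "\<dots> = ennreal (\<Sum>k. (1/2) ^ k)"
    by (intro suminf_ennreal2) (auto simp: summable_geometric)
  also have "\<dots> < \<infinity>" by simp
  finally have "(\<integral>\<^sup>+ x. (\<Sum>k. ?w k x) \<partial>M) \<noteq> \<infinity>" by simp
  then have "AE x in M. (\<Sum>k. ?w k x) \<noteq> \<infinity>"
    by (intro nn_integral_PInf_AE) measurable
  then show ?thesis
  proof eventually_elim
    fix x assume "(\<Sum>k. ?w k x) \<noteq> \<infinity>"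
    then obtain s where s: "s \<ge> 0" "(\<Sum>k. ?w k x) = ennreal s"
      by (cases "\<Sum>k. ?w k x") auto
    have bd: "cmod (d k x) \<le> sqrt s * (sqrt (1/2)) ^ k" for k
    proof -
      have "?w k x \<le> (\<Sum>k. ?w k x)"
        using sum_le_suminf[of "\<lambda>k. ?w k x" "{k}"] by simp
      then have "2 ^ k * (cmod (d k x))\<^sup>2 \<le> s"
        using s by (simp add: ennreal_mult'[symmetric])
      then have "(cmod (d k x))\<^sup>2 \<le> s * (1/2) ^ k"
        by (simp add: power_divide field_simps)
      then have "cmod (d k x) \<le> sqrt (s * (1/2) ^ k)"
        by (rule real_le_rsqrt)
      then show ?thesis by (simp add: real_sqrt_mult real_sqrt_power)
    qed
    show "summable (\<lambda>k. d k x)"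
    proof (rule summable_comparison_test')
      show "summable (\<lambda>k. sqrt s * (sqrt (1/2)) ^ k)"
        by (intro summable_mult summable_geometric) (simp add: real_sqrt_divide)
      show "norm (d k x) \<le> sqrt s * (sqrt (1/2)) ^ k" if "k \<ge> 0" for k
        using bd by simp
    qed
  qed
qed

text \<open>Indices are picked greedily so that the squared distance at stage \<open>k\<close> is
  below \<open>(1/4) ^ k\<close>. The differences are then summable almost everywhere, and the terms
  of a convergent series tend to 0.\<close>

lemma L2_tendsto_AE_subseq:
  assumes F [measurable]: "\<And>n. F n \<in> borel_measurable M" and g [measurable]: "g \<in> borel_measurable M"
    and lim: "L2_tendsto M F g"
  obtains s :: "nat \<Rightarrow> nat" where "strict_mono s" "AE x in M. (\<lambda>k. F (s k) x) \<longlonglongrightarrow> g x"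
proof -
  let ?P = "\<lambda>k n. L2_norm_sq M (\<lambda>x. F n x - g x) < ennreal ((1/4) ^ k)"
  have ev: "eventually (?P k) sequentially" for k
    using lim unfolding L2_tendsto_def by (rule order_tendstoD(2)) simp
  have "\<exists>s. \<forall>k. ?P k (s k) \<and> s k < s (Suc k)"
  proof (rule dependent_nat_choice)
    show "\<exists>n. ?P 0 n"
      using ev[of 0] by (auto simp: eventually_sequentially)
    fix n k
    show "\<exists>m. ?P (Suc k) m \<and> n < m"
      using eventually_conj[OF ev[of "Suc k"] eventually_gt_at_top[of n]]
      by (auto simp: eventually_sequentially)
  qed
  then obtain s where s: "\<And>k. ?P k (s k)" "\<And>k. s k < s (Suc k)" by auto
  have "AE x in M. summable (\<lambda>k. F (s k) x - g x)"
    by (rule AE_summable_of_L2_norm_sq_le) (use s in \<open>auto intro: less_imp_le\<close>)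
  then have "AE x in M. (\<lambda>k. F (s k) x) \<longlonglongrightarrow> g x"
    by eventually_elim (rule LIM_zero_cancel[OF summable_LIMSEQ_zero])
  moreover have "strict_mono s" using s(2) by (rule strict_monoI_Suc)
  ultimately show ?thesis using that by blast
qed

text \<open>This is Fatou's lemma for squared norms. Asking for the bound only eventually suits a
  subsequence, whose first few indices may lie below the range where an estimate holds.\<close>

lemma L2_norm_sq_le_of_AE_tendsto:
  assumes F [measurable]: "\<And>n. F n \<in> borel_measurable M" and g [measurable]: "g \<in> borel_measurable M"
    and lim: "AE x in M. (\<lambda>n. F n x) \<longlonglongrightarrow> g x"
    and le: "eventually (\<lambda>n. L2_norm_sq M (F n) \<le> C) sequentially"
  shows "L2_norm_sq M g \<le> C"
proof -
  have "L2_norm_sq M g = (\<integral>\<^sup>+ x. liminf (\<lambda>n. ennreal ((cmod (F n x))\<^sup>2)) \<partial>M)"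
    unfolding L2_norm_sq_def
  proof (rule nn_integral_cong_AE, use lim in eventually_elim)
    fix x assume "(\<lambda>n. F n x) \<longlonglongrightarrow> g x"
    then have "(\<lambda>n. ennreal ((cmod (F n x))\<^sup>2)) \<longlonglongrightarrow> ennreal ((cmod (g x))\<^sup>2)"
      by (intro tendsto_ennrealI tendsto_intros)
    then show "ennreal ((cmod (g x))\<^sup>2) = liminf (\<lambda>n. ennreal ((cmod (F n x))\<^sup>2))"
      by (rule lim_imp_Liminf[OF sequentially_bot, symmetric])
  qed
  also have "\<dots> \<le> liminf (\<lambda>n. L2_norm_sq M (F n))"
    unfolding L2_norm_sq_def by (rule nn_integral_liminf) simp
  also have "\<dots> \<le> liminf (\<lambda>n. C)"
    by (rule Liminf_mono[OF le])
  finally show ?thesis by (simp add: Liminf_const)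
qed

text \<open>The Riesz-Fischer argument: along a rapidly Cauchy subsequence the telescoping
  differences are summable almost everywhere, which produces the limit \<open>g\<close>. Fatou's
  lemma in the later index then bounds the squared distance from \<open>F m\<close> to
  \<open>g\<close> by \<open>e m\<close>, so the whole sequence converges.\<close>

lemma L2_complete:
  assumes F [measurable]: "\<And>n. F n \<in> borel_measurable M"
    and e: "e \<longlonglongrightarrow> 0"
    and le: "\<And>m n. m \<le> n \<Longrightarrow> L2_norm_sq M (\<lambda>x. F n x - F m x) \<le> e m"
  obtains g where "g \<in> borel_measurable M" "L2_tendsto M F g"
proof -
  let ?P = "\<lambda>k n. e n < ennreal ((1/4) ^ k)"
  have ev: "eventually (?P k) sequentially" for k
    using e by (rule order_tendstoD(2)) simp
  have "\<exists>s. \<forall>k. ?P k (s k) \<and> s k < s (Suc k)"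
  proof (rule dependent_nat_choice)
    show "\<exists>n. ?P 0 n"
      using ev[of 0] by (auto simp: eventually_sequentially)
    fix n k
    show "\<exists>m. ?P (Suc k) m \<and> n < m"
      using eventually_conj[OF ev[of "Suc k"] eventually_gt_at_top[of n]]
      by (auto simp: eventually_sequentially)
  qed
  then obtain s where s: "\<And>k. ?P k (s k)" "\<And>k. s k < s (Suc k)" by auto
  have mono: "strict_mono s" using s(2) by (rule strict_monoI_Suc)
  have "AE x in M. summable (\<lambda>k. F (s (Suc k)) x - F (s k) x)"
  proof (rule AE_summable_of_L2_norm_sq_le)
    fix k
    have "L2_norm_sq M (\<lambda>x. F (s (Suc k)) x - F (s k) x) \<le> e (s k)"
      using s(2) by (intro le less_imp_le)
    also have "\<dots> \<le> ennreal ((1/4) ^ k)"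
      using s(1) by (rule less_imp_le)
    finally show "L2_norm_sq M (\<lambda>x. F (s (Suc k)) x - F (s k) x) \<le> ennreal ((1/4) ^ k)" .
  qed simp
  then have conv: "AE x in M. convergent (\<lambda>k. F (s k) x)"
  proof eventually_elim
    case (elim x)
    then have "convergent (\<lambda>n. \<Sum>k<n. F (s (Suc k)) x - F (s k) x)"
      by (simp add: summable_iff_convergent)
    then have "convergent (\<lambda>n. (F (s n) x - F (s 0) x) + F (s 0) x)"
      unfolding sum_lessThan_telescope[of "\<lambda>k. F (s k) x"] by (intro convergent_add convergent_const)
    then show ?case by simp
  qed
  \<comment> \<open>On the null set where the subsequence diverges, \<open>lim\<close> has an
    unspecified value; measurability holds all the same.\<close>
  define g where "g = (\<lambda>x. lim (\<lambda>k. F (s k) x))"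
  have g [measurable]: "g \<in> borel_measurable M"
    unfolding g_def by measurable
  have lim: "AE x in M. (\<lambda>k. F (s k) x) \<longlonglongrightarrow> g x"
    using conv by eventually_elim (simp add: g_def convergent_LIMSEQ_iff)
  have "L2_norm_sq M (\<lambda>x. F m x - g x) \<le> e m" for m
  proof -
    have "L2_norm_sq M (\<lambda>x. g x - F m x) \<le> e m"
    proof (rule L2_norm_sq_le_of_AE_tendsto[where F = "\<lambda>k x. F (s k) x - F m x"])
      show "AE x in M. (\<lambda>k. F (s k) x - F m x) \<longlonglongrightarrow> g x - F m x"
        using lim by eventually_elim (intro tendsto_intros)
      show "eventually (\<lambda>k. L2_norm_sq M (\<lambda>x. F (s k) x - F m x) \<le> e m) sequentially"
        using eventually_ge_at_top[of m]
      proof eventually_elim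
        case (elim k)
        then have "m \<le> s k" using strict_mono_imp_increasing[OF mono, of k] by simp
        then show ?case by (rule le)
      qed
    qed auto
    then show ?thesis by (simp add: L2_norm_sq_diff_commute)
  qed
  then have "L2_tendsto M F g"
    unfolding L2_tendsto_def by (intro tendsto_sandwich[OF _ _ tendsto_const e]) auto
  with g show ?thesis using that by blast
qed

lemma L2_norm_sq_le_of_L2_tendsto:
  assumes "\<And>n. F n \<in> borel_measurable M" "g \<in> borel_measurable M" "L2_tendsto M F g"
    and "\<And>n. L2_norm_sq M (F n) \<le> C"
  shows "L2_norm_sq M g \<le> C"
proof -
  obtain s where "strict_mono s" "AE x in M. (\<lambda>k. F (s k) x) \<longlonglongrightarrow> g x"
    using L2_tendsto_AE_subseq[OF assms(1-3)] .
  note s = this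
  show ?thesis
    by (rule L2_norm_sq_le_of_AE_tendsto[OF assms(1,2) s(2)]) (simp add: assms(4))
qed

text \<open>This identifies a limit chosen by \<open>SOME\<close> with an explicit function: a
  subsequence converges almost everywhere to \<open>g\<close>, while the full sequence already
  converges to \<open>h\<close>.\<close>

lemma L2_tendsto_AE_eq:
  assumes "\<And>n. F n \<in> borel_measurable M" "g \<in> borel_measurable M" "L2_tendsto M F g"
    and lim: "\<And>x. (\<lambda>n. F n x) \<longlonglongrightarrow> h x"
  shows "AE x in M. g x = h x"
proof -
  obtain s where s: "strict_mono s" "AE x in M. (\<lambda>k. F (s k) x) \<longlonglongrightarrow> g x"
    using L2_tendsto_AE_subseq[OF assms(1-3)] .
  from s(2) show ?thesis
  proof eventually_elim
    case (elim x)
    moreover have "(\<lambda>k. F (s k) x) \<longlonglongrightarrow> h x"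
      using LIMSEQ_subseq_LIMSEQ[OF lim s(1), of x] by (simp add: o_def)
    ultimately show ?case by (rule LIMSEQ_unique)
  qed
qed

section \<open>Bessel's inequality on an interval\<close>

lemma borel_measurable_cis [measurable]: "cis \<in> borel_measurable borel"
  by (intro borel_measurable_continuous_onI continuous_intros)

lemma borel_measurable_cnj [measurable]: "cnj \<in> borel_measurable borel"
  by (intro borel_measurable_continuous_onI continuous_intros)

lemma finite_measure_interval: "finite_measure (restrict_space lborel {a..<b::real})"
  by (rule finite_measureI, cases "a \<le> b") (simp_all add: emeasure_restrict_space space_restrict_space)

text \<open>The left endpoint is arbitrary because the intervals that occur later are supports and
  frequency cells placed anywhere on the line.\<close>

lemma integral_cis_period:
  fixes a L :: real
  assumes "L > 0"
  shows "(LINT x|restrict_space lborel {a..<a+L}. cis (2 * pi * of_int k / L * x)) = (if k = 0 then of_real L else 0)"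
proof -
  define c where "c = 2 * pi * of_int k / L"
  have "(LINT x|restrict_space lborel {a..<a+L}. cis (c * x)) =
      (LINT x|lborel. indicator {a..<a+L} x *\<^sub>R cis (c * x))"
    by (rule integral_restrict_space) simp
  \<comment> \<open>The right endpoint is a null set; adding it gives the closed interval on which
    the fundamental theorem of calculus is applied.\<close>
  also have "\<dots> = (LINT x|lborel. indicator {a..a+L} x *\<^sub>R cis (c * x))"
    by (rule integral_cong_AE)
      (auto intro!: eventually_mono[OF AE_lborel_singleton[of "a + L"]] split: split_indicator)
  also have "\<dots> = (if k = 0 then of_real L else 0)"
  proof (cases "k = 0")
    case True
    then show ?thesis using assms by (simp add: c_def scaleR_conv_of_real)
  next
    case False
    then have c: "c \<noteq> 0" using assms by (simp add: c_def)
    let ?F = "\<lambda>x. cis (c * x) / (\<i> * of_real c)"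
    have "(LINT x|lborel. indicator {a..a+L} x *\<^sub>R cis (c * x)) = ?F (a + L) - ?F a"
    proof (rule integral_FTC_Icc)
      fix x
      have "((\<lambda>x. cis (c * x)) has_derivative (\<lambda>t. (c * t) *\<^sub>R (\<i> * cis (c * x)))) (at x within {a..a+L})"
        by (intro has_derivative_cis has_derivative_mult_right has_derivative_ident)
      from bounded_linear.has_derivative[OF bounded_linear_divide this, of "\<i> * of_real c"]
      have "(?F has_derivative (\<lambda>t. (c * t) *\<^sub>R (\<i> * cis (c * x)) / (\<i> * of_real c))) (at x within {a..a+L})" .
      moreover have "(c * t) *\<^sub>R (\<i> * cis (c * x)) / (\<i> * of_real c) = t *\<^sub>R cis (c * x)" for t
        by (subst nonzero_divide_eq_eq) (use c in \<open>auto simp: scaleR_conv_of_real\<close>)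
      ultimately show "(?F has_vector_derivative cis (c * x)) (at x within {a..a+L})"
        unfolding has_vector_derivative_def by (simp only:)
    qed (use assms in \<open>auto intro!: continuous_intros\<close>)
    also have "cis (c * (a + L)) = cis (c * a) * cis (2 * pi * of_int k)"
      unfolding cis_mult using assms by (simp add: c_def field_simps)
    also have "cis (2 * pi * of_int k) = 1"
      by (rule cis_multiple_2pi) simp
    finally show ?thesis using False by simp
  qed
  finally show ?thesis by (simp add: c_def)
qed

lemma integral_cis_orthogonal:
  fixes a L :: real
  assumes "L > 0"
  shows "(LINT x|restrict_space lborel {a..<a+L}.
      cis (2 * pi * of_int k / L * x) * cnj (cis (2 * pi * of_int j / L * x))) = (if k = j then of_real L else 0)"
proof -
  have "cis (2 * pi * of_int k / L * x) * cnj (cis (2 * pi * of_int j / L * x)) = cis (2 * pi * of_int (k - j) / L * x)" for x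
    by (simp add: cis_cnj cis_mult diff_divide_distrib algebra_simps)
  then show ?thesis
    using integral_cis_period[OF assms, of a "k - j"] by simp
qed

text \<open>Expanding the square gives a double sum in which orthogonality leaves only the diagonal,
  each term contributing a factor \<open>L\<close>.\<close>

lemma integral_norm_sq_trig_sum:
  fixes a L :: real
  assumes "L > 0" "finite K"
  shows "(LINT x|restrict_space lborel {a..<a+L}. (cmod (\<Sum>k\<in>K. b k * cis (2 * pi * of_int k / L * x)))\<^sup>2)
    = L * (\<Sum>k\<in>K. (cmod (b k))\<^sup>2)" (is "integral\<^sup>L ?M _ = _")
proof -
  interpret finite_measure ?M by (rule finite_measure_interval)
  let ?e = "\<lambda>k x. cis (2 * pi * of_int k / L * x)"
  have int: "integrable ?M (\<lambda>x. b k * cnj (b j) * (?e k x * cnj (?e j x)))" for k j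
    by (rule integrable_mult_right, rule integrable_const_bound[where B = 1])
      (auto simp: norm_mult intro!: measurable_restrict_space1)
  have "of_real (LINT x|?M. (cmod (\<Sum>k\<in>K. b k * ?e k x))\<^sup>2)
      = (LINT x|?M. complex_of_real ((cmod (\<Sum>k\<in>K. b k * ?e k x))\<^sup>2))"
    by (rule integral_complex_of_real[symmetric])
  also have "\<dots> = (LINT x|?M. (\<Sum>k\<in>K. (\<Sum>j\<in>K. b k * cnj (b j) * (?e k x * cnj (?e j x)))))"
    by (rule Bochner_Integration.integral_cong)
      (simp_all add: complex_norm_square sum_product mult_ac del: of_real_power)
  also have "\<dots> = (\<Sum>k\<in>K. \<Sum>j\<in>K. b k * cnj (b j) * (if k = j then of_real L else 0))"
    by (simp only: Bochner_Integration.integral_sum Bochner_Integration.integrable_sum int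
        integral_mult_right_zero integral_cis_orthogonal[OF assms(1)])
  also have "\<dots> = (\<Sum>k\<in>K. of_real (L * (cmod (b k))\<^sup>2))"
    using assms(2) by (simp add: if_distrib sum.delta complex_norm_square mult_ac del: of_real_power cong: if_cong)
  also have "\<dots> = of_real (L * (\<Sum>k\<in>K. (cmod (b k))\<^sup>2))"
    by (simp add: sum_distrib_left)
  finally show ?thesis by (simp only: of_real_eq_iff)
qed

text \<open>The squared distance from \<open>\<psi>\<close> to its projection onto finitely many
  exponentials is nonnegative. Two instances matter: a lattice of frequencies, which leads to
  Plancherel, and \<open>K = {0}\<close>, which is the Cauchy-Schwarz inequality against the
  constant 1.\<close>

lemma bessel_inequality:
  fixes a L :: real
  assumes L: "L > 0" and K: "finite K"
    and int: "integrable (restrict_space lborel {a..<a+L}) \<psi>" (is "integrable ?M _")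
    and int2: "integrable (restrict_space lborel {a..<a+L}) (\<lambda>x. (cmod (\<psi> x))\<^sup>2)"
  shows "(\<Sum>k\<in>K. (cmod (LINT x|restrict_space lborel {a..<a+L}. cis (2 * pi * of_int k / L * x) * \<psi> x))\<^sup>2)
    \<le> L * (LINT x|restrict_space lborel {a..<a+L}. (cmod (\<psi> x))\<^sup>2)"
proof -
  interpret finite_measure ?M by (rule finite_measure_interval)
  let ?e = "\<lambda>k x. cis (2 * pi * of_int k / L * x)"
  define c where "c k = (LINT x|?M. ?e k x * \<psi> x)" for k
  define S where "S = (\<Sum>k\<in>K. (cmod (c k))\<^sup>2)"
  \<comment> \<open>The coefficients \<open>c k\<close> carry the exponential itself and not its
    conjugate, so the projection is spanned by the conjugate exponentials.\<close>
  define P where "P x = (\<Sum>k\<in>K. (c k / of_real L) * cnj (?e k x))" for x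
  have em: "?e k \<in> borel_measurable ?M" for k
    by (intro measurable_restrict_space1) simp
  have inte: "integrable ?M (\<lambda>x. ?e k x * \<psi> x)" for k
    by (rule Bochner_Integration.integrable_bound[OF int]) 
      (use em borel_measurable_integrable[OF int] in \<open>auto simp: norm_mult\<close>)
  have P_eq: "P x = cnj (\<Sum>k\<in>K. cnj (c k / of_real L) * ?e k x)" for x
    by (simp add: P_def)
  have Pm: "P \<in> borel_measurable ?M" unfolding P_def using em by measurable
  have cmodP: "(LINT x|?M. (cmod (P x))\<^sup>2) = S / L"
  proof -
    have "(LINT x|?M. (cmod (P x))\<^sup>2) = L * (\<Sum>k\<in>K. (cmod (cnj (c k / of_real L)))\<^sup>2)"
      using integral_norm_sq_trig_sum[OF L K, of a "\<lambda>k. cnj (c k / of_real L)"]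
      by (simp only: P_eq complex_mod_cnj)
    also have "\<dots> = S / L"
      using L by (simp add: S_def norm_divide power_divide sum_divide_distrib[symmetric] power2_eq_square)
    finally show ?thesis .
  qed
  have intP: "integrable ?M (\<lambda>x. (cmod (P x))\<^sup>2)"
  proof (rule integrable_const_bound[where B = "(\<Sum>k\<in>K. cmod (c k / of_real L))\<^sup>2"])
    have "cmod (P x) \<le> (\<Sum>k\<in>K. cmod (c k / of_real L))" for x
      unfolding P_def by (rule order_trans[OF norm_sum]) (simp add: norm_mult norm_divide)
    then show "AE x in ?M. norm ((cmod (P x))\<^sup>2) \<le> (\<Sum>k\<in>K. cmod (c k / of_real L))\<^sup>2"
      by (auto intro!: power_mono)
  qed (use Pm in measurable)
  \<comment> \<open>The inner product of \<open>\<psi>\<close> with its projection equals the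
    squared norm of the projection, \<open>S / L\<close>, so the square expands to the squared norm
    of \<open>\<psi>\<close> minus \<open>S / L\<close>.\<close>
  have cross: "has_bochner_integral ?M (\<lambda>x. Re (\<psi> x * cnj (P x))) (S / L)"
  proof -
    have "has_bochner_integral ?M (\<lambda>x. \<Sum>k\<in>K. cnj (c k / of_real L) * (?e k x * \<psi> x))
        (\<Sum>k\<in>K. cnj (c k / of_real L) * c k)"
      unfolding c_def by (intro has_bochner_integral_sum has_bochner_integral_mult_right has_bochner_integral_integrable inte)
    from has_bochner_integral_Re[OF this]
    have "has_bochner_integral ?M (\<lambda>x. Re (\<Sum>k\<in>K. cnj (c k / of_real L) * (?e k x * \<psi> x)))
        (Re (\<Sum>k\<in>K. cnj (c k / of_real L) * c k))" .
    moreover have "(\<Sum>k\<in>K. cnj (c k / of_real L) * c k) = of_real (S / L)"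
      by (simp add: S_def sum_divide_distrib complex_norm_square mult.commute del: of_real_power)
    moreover have "(\<Sum>k\<in>K. cnj (c k / of_real L) * (?e k x * \<psi> x)) = \<psi> x * cnj (P x)" for x
      unfolding P_eq by (simp add: sum_distrib_left mult_ac del: cis_cnj)
    ultimately show ?thesis by (simp only: Re_complex_of_real)
  qed
  have "0 \<le> (LINT x|?M. (cmod (\<psi> x - P x))\<^sup>2)" by simp
  also have "\<dots> = (LINT x|?M. (cmod (\<psi> x))\<^sup>2 - 2 * Re (\<psi> x * cnj (P x)) + (cmod (P x))\<^sup>2)"
    by (rule Bochner_Integration.integral_cong)
      (simp_all add: cmod_power2 power2_diff algebra_simps)
  also have "\<dots> = (LINT x|?M. (cmod (\<psi> x))\<^sup>2) - 2 * (S / L) + S / L"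
  proof -
    have "integrable ?M (\<lambda>x. Re (\<psi> x * cnj (P x)))" "(LINT x|?M. Re (\<psi> x * cnj (P x))) = S / L"
      using cross by (simp_all only: has_bochner_integral_iff)
    then show ?thesis
      using int2 intP cmodP by (simp del: times_complex.sel)
  qed
  finally show ?thesis using L by (simp add: S_def c_def field_simps)
qed

section \<open>The Fourier transform on the line\<close>

text \<open>One unnormalised integral with positive sign serves both directions: the forward
  transform is its value at \<open>- \<xi>\<close>, the inverse transform is its quotient by
  \<open>2 * pi\<close>.\<close>

definition fourier_int :: "(real \<Rightarrow> complex) \<Rightarrow> real \<Rightarrow> complex" where
  "fourier_int \<psi> \<xi> = (LINT x|lborel. cis (x * \<xi>) * \<psi> x)"

lemma borel_measurable_fourier_int [measurable]:
  assumes [measurable]: "\<psi> \<in> borel_measurable borel"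
  shows "fourier_int \<psi> \<in> borel_measurable borel"
  unfolding fourier_int_def[abs_def] by measurable

lemma integrable_cis_mult:
  assumes f: "f \<in> borel_measurable borel" and \<psi>: "integrable lborel \<psi>"
  shows "integrable lborel (\<lambda>x. cis (f x) * \<psi> x)"
proof (rule Bochner_Integration.integrable_bound[OF \<psi>])
  note [measurable] = f borel_measurable_integrable[OF \<psi>]
  show "(\<lambda>x. cis (f x) * \<psi> x) \<in> borel_measurable lborel" by measurable
qed (simp add: norm_mult)

lemma fourier_int_diff:
  assumes "integrable lborel \<psi>" "integrable lborel \<phi>"
  shows "fourier_int (\<lambda>x. \<psi> x - \<phi> x) \<xi> = fourier_int \<psi> \<xi> - fourier_int \<phi> \<xi>"
  unfolding fourier_int_def
  by (simp add: right_diff_distrib Bochner_Integration.integral_diff integrable_cis_mult assms)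

lemma L2_spaceD:
  assumes "\<psi> \<in> L2_space M"
  shows "\<psi> \<in> borel_measurable M" "integrable M (\<lambda>x. (cmod (\<psi> x))\<^sup>2)"
    "L2_norm_sq M \<psi> = ennreal (LINT x|M. (cmod (\<psi> x))\<^sup>2)"
proof -
  show m [measurable]: "\<psi> \<in> borel_measurable M" using assms by (simp add: L2_space_def)
  show i: "integrable M (\<lambda>x. (cmod (\<psi> x))\<^sup>2)"
    using assms by (intro integrableI_bounded) (auto simp: L2_space_def L2_norm_sq_def)
  show "L2_norm_sq M \<psi> = ennreal (LINT x|M. (cmod (\<psi> x))\<^sup>2)"
    unfolding L2_norm_sq_def by (rule nn_integral_eq_integral[OF i]) simp
qed

text \<open>The modulus is at most 1 plus its square, and the constant 1 is integrable over the
  bounded support.\<close>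

lemma integrable_of_L2_bounded_support:
  assumes \<psi>: "\<psi> \<in> L2_space lborel" and supp: "\<And>x. x \<notin> {a..<b} \<Longrightarrow> \<psi> x = 0"
  shows "integrable lborel \<psi>"
proof (rule Bochner_Integration.integrable_bound)
  show "integrable lborel (\<lambda>x. indicator {a..<b} x + (cmod (\<psi> x))\<^sup>2)"
    using L2_spaceD(2)[OF \<psi>] by (cases "a \<le> b") auto
  show "\<psi> \<in> borel_measurable lborel" by (rule L2_spaceD(1)[OF \<psi>])
  have "cmod z \<le> 1 + (cmod z)\<^sup>2" for z
  proof (cases "cmod z \<le> 1")
    case False
    then have "cmod z * 1 \<le> cmod z * cmod z" by (intro mult_left_mono) auto
    then show ?thesis by (simp add: power2_eq_square)
  qed (simp add: add_increasing2)
  then show "AE x in lborel. norm (\<psi> x) \<le> norm (indicator {a..<b} x + (cmod (\<psi> x))\<^sup>2)"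
    using supp by (auto split: split_indicator)
qed

text \<open>For \<open>\<psi>\<close> supported in an interval of length \<open>L\<close>, the
  values of its transform on the shifted lattice are the Bessel coefficients of the modulation
  \<open>cis (x * t) * \<psi> x\<close>, which has the same modulus as
  \<open>\<psi>\<close>.\<close>

lemma sum_fourier_int_sq_le:
  assumes \<psi>: "\<psi> \<in> L2_space lborel" and L: "L > 0" and supp: "\<And>x. x \<notin> {a..<a+L} \<Longrightarrow> \<psi> x = 0" and K: "finite K"
  shows "(\<Sum>k\<in>K. ennreal ((cmod (fourier_int \<psi> (2 * pi * of_int k / L + t)))\<^sup>2)) \<le> ennreal L * L2_norm_sq lborel \<psi>"
proof -
  let ?M = "restrict_space lborel {a..<a+L}"
  let ?f = "\<lambda>x. cis (x * t) * \<psi> x"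
  \<comment> \<open>Since the integrands vanish off the interval, restricted integrals and integrals
    over the line agree.\<close>
  have supp': "indicator {a..<a+L} x *\<^sub>R g x = g x" if "\<psi> x = 0 \<Longrightarrow> g x = 0" for x and g :: "real \<Rightarrow> 'b::real_vector"
    using that supp[of x] by (cases "x \<in> {a..<a+L}") auto
  have int: "integrable lborel \<psi>" by (rule integrable_of_L2_bounded_support[OF \<psi> supp])
  have "integrable ?M ?f"
    by (subst integrable_restrict_space) (simp_all add: supp'[of _ ?f] integrable_cis_mult int)
  moreover have "integrable ?M (\<lambda>x. (cmod (?f x))\<^sup>2)"
    by (subst integrable_restrict_space) (simp_all add: supp'[of _ "\<lambda>x. (cmod (\<psi> x))\<^sup>2"] norm_mult L2_spaceD(2)[OF \<psi>] del: real_scaleR_def)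
  ultimately have "(\<Sum>k\<in>K. (cmod (LINT x|?M. cis (2 * pi * of_int k / L * x) * ?f x))\<^sup>2)
    \<le> L * (LINT x|?M. (cmod (?f x))\<^sup>2)"
    by (rule bessel_inequality[OF L K])
  moreover have "(LINT x|?M. cis (2 * pi * of_int k / L * x) * ?f x) = fourier_int \<psi> (2 * pi * of_int k / L + t)" for k
  proof -
    have "(LINT x|?M. cis (2 * pi * of_int k / L * x) * ?f x) = (LINT x|lborel. cis (2 * pi * of_int k / L * x) * ?f x)"
      by (subst integral_restrict_space, simp, rule Bochner_Integration.integral_cong[OF refl], rule supp') simp
    also have "\<dots> = fourier_int \<psi> (2 * pi * of_int k / L + t)"
      unfolding fourier_int_def mult.assoc[symmetric] cis_mult by (simp add: algebra_simps)
    finally show ?thesis .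
  qed
  moreover have "(LINT x|?M. (cmod (?f x))\<^sup>2) = (LINT x|lborel. (cmod (\<psi> x))\<^sup>2)"
    by (subst integral_restrict_space)
      (simp_all add: supp'[of _ "\<lambda>x. (cmod (\<psi> x))\<^sup>2"] norm_mult del: real_scaleR_def)
  ultimately have "(\<Sum>k\<in>K. (cmod (fourier_int \<psi> (2 * pi * of_int k / L + t)))\<^sup>2) \<le> L * (LINT x|lborel. (cmod (\<psi> x))\<^sup>2)"
    by simp
  then show ?thesis
    using L by (simp add: L2_spaceD(3)[OF \<psi>] ennreal_mult'[symmetric])
qed

text \<open>Integrating Bessel's inequality over all translates of the frequency lattice yields the
  upper half of Plancherel's identity.\<close>

lemma plancherel_le:
  assumes \<psi>: "\<psi> \<in> L2_space lborel" and L: "L > 0" and supp: "\<And>x. x \<notin> {a..<a+L} \<Longrightarrow> \<psi> x = 0"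
  shows "L2_norm_sq lborel (fourier_int \<psi>) \<le> ennreal (2 * pi) * L2_norm_sq lborel \<psi>"
proof -
  define \<delta> where "\<delta> = 2 * pi / L"
  have \<delta>: "\<delta> > 0" using L by (simp add: \<delta>_def)
  have [measurable]: "\<psi> \<in> borel_measurable borel" using L2_spaceD(1)[OF \<psi>] by simp
  define g where "g \<xi> = ennreal ((cmod (fourier_int \<psi> \<xi>))\<^sup>2)" for \<xi>
  have [measurable]: "g \<in> borel_measurable borel" unfolding g_def by measurable
  let ?I = "\<lambda>n. {- (real n * \<delta>)..<real n * \<delta>}"
  let ?K = "\<lambda>n. {- int n..<int n}"
  have le: "(\<integral>\<^sup>+ \<xi>. g \<xi> * indicator (?I n) \<xi> \<partial>lborel) \<le> ennreal (2 * pi) * L2_norm_sq lborel \<psi>" for n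
  proof -
    have "(\<integral>\<^sup>+ \<xi>. g \<xi> * indicator (?I n) \<xi> \<partial>lborel)
        \<le> (\<integral>\<^sup>+ \<xi>. (\<Sum>k\<in>?K n. g \<xi> * indicator {0..<\<delta>} (\<xi> - of_int k * \<delta>)) \<partial>lborel)"
    proof (rule nn_integral_mono)
      fix \<xi> :: real
      show "g \<xi> * indicator (?I n) \<xi> \<le> (\<Sum>k\<in>?K n. g \<xi> * indicator {0..<\<delta>} (\<xi> - of_int k * \<delta>))"
      proof (cases "\<xi> \<in> ?I n")
        case True
        \<comment> \<open>This is the index of the lattice cell of length \<open>\<delta>\<close>
          that contains \<open>\<xi>\<close>; the half-open range of \<open>\<xi>\<close> forces it
          into the half-open range \<open>?K n\<close>.\<close>
        define k where "k = \<lfloor>\<xi> / \<delta>\<rfloor>"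
        have "- real n \<le> \<xi> / \<delta>" "\<xi> / \<delta> < real n"
          using True \<delta> by (simp_all add: field_simps)
        then have k: "k \<in> ?K n" unfolding k_def by (simp add: le_floor_iff floor_less_iff)
        have "of_int k \<le> \<xi> / \<delta>" "\<xi> / \<delta> < of_int k + 1"
          unfolding k_def by linarith+
        then have "\<xi> - of_int k * \<delta> \<in> {0..<\<delta>}" using \<delta> by (simp add: field_simps)
        then have "g \<xi> * indicator (?I n) \<xi> = g \<xi> * indicator {0..<\<delta>} (\<xi> - of_int k * \<delta>)"
          using True by simp
        also have "\<dots> \<le> (\<Sum>k\<in>?K n. g \<xi> * indicator {0..<\<delta>} (\<xi> - of_int k * \<delta>))"
          by (rule member_le_sum[OF k]) auto
        finally show ?thesis .
      qed simp
    qed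
    also have "\<dots> = (\<Sum>k\<in>?K n. (\<integral>\<^sup>+ \<xi>. g \<xi> * indicator {0..<\<delta>} (\<xi> - of_int k * \<delta>) \<partial>lborel))"
      by (rule nn_integral_sum) measurable
    also have "\<dots> = (\<Sum>k\<in>?K n. (\<integral>\<^sup>+ t. g (of_int k * \<delta> + t) * indicator {0..<\<delta>} t \<partial>lborel))"
    \<comment> \<open>Each cell is translated back to \<open>{0..<\<delta>}\<close>, so that all
      cells share the variable \<open>t\<close>.\<close>
    proof (rule sum.cong[OF refl])
      fix k :: int
      show "(\<integral>\<^sup>+ \<xi>. g \<xi> * indicator {0..<\<delta>} (\<xi> - of_int k * \<delta>) \<partial>lborel) =
          (\<integral>\<^sup>+ t. g (of_int k * \<delta> + t) * indicator {0..<\<delta>} t \<partial>lborel)"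
        by (subst nn_integral_real_affine[where c = 1 and t = "of_int k * \<delta>"]) simp_all
    qed
    also have "\<dots> = (\<integral>\<^sup>+ t. (\<Sum>k\<in>?K n. g (of_int k * \<delta> + t) * indicator {0..<\<delta>} t) \<partial>lborel)"
      by (rule nn_integral_sum[symmetric]) measurable
    also have "\<dots> \<le> (\<integral>\<^sup>+ t. (ennreal L * L2_norm_sq lborel \<psi>) * indicator {0..<\<delta>} t \<partial>lborel)"
    proof (rule nn_integral_mono)
      fix t
      \<comment> \<open>For a fixed offset \<open>t\<close> the sum over cells runs over one
        translate of the lattice, and Bessel bounds it independently of \<open>n\<close> and
        \<open>t\<close>.\<close>
      have "(\<Sum>k\<in>?K n. g (2 * pi * of_int k / L + t)) \<le> ennreal L * L2_norm_sq lborel \<psi>"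
        unfolding g_def by (rule sum_fourier_int_sq_le[OF \<psi> L supp]) auto
      then have "(\<Sum>k\<in>?K n. g (of_int k * \<delta> + t)) \<le> ennreal L * L2_norm_sq lborel \<psi>"
        by (simp add: \<delta>_def mult_ac)
      then show "(\<Sum>k\<in>?K n. g (of_int k * \<delta> + t) * indicator {0..<\<delta>} t)
          \<le> (ennreal L * L2_norm_sq lborel \<psi>) * indicator {0..<\<delta>} t"
        unfolding sum_distrib_right[symmetric] by (rule mult_right_mono) simp
    qed
    also have "\<dots> = (ennreal L * L2_norm_sq lborel \<psi>) * ennreal \<delta>"
      using \<delta> by (simp add: nn_integral_cmult_indicator)
    also have "\<dots> = ennreal (L * \<delta>) * L2_norm_sq lborel \<psi>"
      using L \<delta> by (simp add: ennreal_mult' mult_ac)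
    \<comment> \<open>The Bessel constant \<open>L\<close> times the cell length gives a bound in
      which the size of the support has disappeared. This is what makes it usable for all
      truncations at once.\<close>
    also have "L * \<delta> = 2 * pi" using L by (simp add: \<delta>_def)
    finally show ?thesis .
  qed
  show ?thesis
  \<comment> \<open>The windows \<open>?I n\<close> exhaust the frequency line, and Fatou's lemma
    removes the truncation.\<close>
  proof (rule L2_norm_sq_le_of_AE_tendsto[where F = "\<lambda>n \<xi>. indicator (?I n) \<xi> * fourier_int \<psi> \<xi>"])
    show "AE \<xi> in lborel. (\<lambda>n. indicator (?I n) \<xi> * fourier_int \<psi> \<xi>) \<longlonglongrightarrow> fourier_int \<psi> \<xi>"
    proof (rule AE_I2)
      fix \<xi> :: real
      have "filterlim (\<lambda>n. real n * \<delta>) at_top sequentially"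
        using \<delta> by (intro filterlim_at_top_mult_tendsto_pos[OF tendsto_const] filterlim_real_sequentially)
      then have "eventually (\<lambda>n. real n * \<delta> > \<bar>\<xi>\<bar>) sequentially"
        by (rule filterlim_at_top_dense[THEN iffD1, rule_format])
      then have "eventually (\<lambda>n. indicator (?I n) \<xi> * fourier_int \<psi> \<xi> = fourier_int \<psi> \<xi>) sequentially"
        by eventually_elim (auto simp: indicator_def)
      then show "(\<lambda>n. indicator (?I n) \<xi> * fourier_int \<psi> \<xi>) \<longlonglongrightarrow> fourier_int \<psi> \<xi>"
        by (rule tendsto_eventually)
    qed
    have "L2_norm_sq lborel (\<lambda>\<xi>. indicator (?I n) \<xi> * fourier_int \<psi> \<xi>) = (\<integral>\<^sup>+ \<xi>. g \<xi> * indicator (?I n) \<xi> \<partial>lborel)" for n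
      unfolding L2_norm_sq_def g_def by (rule nn_integral_cong) (auto split: split_indicator)
    then show "eventually (\<lambda>n. L2_norm_sq lborel (\<lambda>\<xi>. indicator (?I n) \<xi> * fourier_int \<psi> \<xi>)
        \<le> ennreal (2 * pi) * L2_norm_sq lborel \<psi>) sequentially"
      using le by simp
  qed auto
qed

section \<open>Truncated Fourier integrals and the L2 transform\<close>

definition cutoff :: "nat \<Rightarrow> (real \<Rightarrow> complex) \<Rightarrow> real \<Rightarrow> complex" where
  "cutoff N \<phi> x = indicator {- real N..real N} x * \<phi> x"

lemma cutoff_in_L2:
  assumes "\<phi> \<in> L2_space lborel"
  shows "cutoff N \<phi> \<in> L2_space lborel" "L2_norm_sq lborel (cutoff N \<phi>) \<le> L2_norm_sq lborel \<phi>"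
proof -
  show le: "L2_norm_sq lborel (cutoff N \<phi>) \<le> L2_norm_sq lborel \<phi>"
    unfolding L2_norm_sq_def cutoff_def by (rule nn_integral_mono) (auto split: split_indicator)
  have [measurable]: "\<phi> \<in> borel_measurable borel" using L2_spaceD(1)[OF assms] by simp
  have "cutoff N \<phi> \<in> borel_measurable lborel" unfolding cutoff_def[abs_def] by measurable
  then show "cutoff N \<phi> \<in> L2_space lborel"
    using le assms by (auto simp: L2_space_def intro: le_less_trans)
qed

text \<open>The support is fitted into a half-open interval; the extra 1 on each side takes in the
  endpoint \<open>real N\<close> and keeps the length positive when \<open>N = 0\<close>.\<close>

lemma cutoff_eq_0: "x \<notin> {- (real N + 1)..<- (real N + 1) + 2 * (real N + 1)} \<Longrightarrow> cutoff N \<phi> x = 0"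
  by (auto simp: cutoff_def indicator_def)

lemma integrable_cutoff:
  assumes "\<phi> \<in> L2_space lborel"
  shows "integrable lborel (cutoff N \<phi>)"
  by (rule integrable_of_L2_bounded_support[OF cutoff_in_L2(1)[OF assms] cutoff_eq_0])

lemma plancherel_cutoff:
  assumes "\<phi> \<in> L2_space lborel"
  shows "L2_norm_sq lborel (fourier_int (cutoff N \<phi>)) \<le> ennreal (2 * pi) * L2_norm_sq lborel \<phi>"
proof -
  have "L2_norm_sq lborel (fourier_int (cutoff N \<phi>)) \<le> ennreal (2 * pi) * L2_norm_sq lborel (cutoff N \<phi>)"
    using cutoff_eq_0 by (intro plancherel_le[OF cutoff_in_L2(1)[OF assms], of "2 * (real N + 1)" "- (real N + 1)"]) auto
  also have "\<dots> \<le> ennreal (2 * pi) * L2_norm_sq lborel \<phi>"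
    by (intro mult_left_mono cutoff_in_L2(2) assms) simp
  finally show ?thesis .
qed

text \<open>The mass \<open>e m\<close> of \<open>\<phi>\<close> outside
  \<open>{- real m..real m}\<close> tends to 0 by dominated convergence. Plancherel's bound for the
  difference of two truncations turns \<open>2 * pi\<close> times \<open>e m\<close> into a Cauchy
  modulus for their transforms.\<close>

lemma fourier_int_cutoff_converges:
  assumes \<phi>: "\<phi> \<in> L2_space lborel"
  obtains g where "g \<in> borel_measurable lborel" "L2_tendsto lborel (\<lambda>N. fourier_int (cutoff N \<phi>)) g"
proof -
  have [measurable]: "\<phi> \<in> borel_measurable borel" using L2_spaceD(1)[OF \<phi>] by simp
  have [measurable]: "cutoff N \<phi> \<in> borel_measurable borel" for N
    using cutoff_in_L2(1)[OF \<phi>, THEN L2_spaceD(1)] by simp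
  define e where "e m = (\<integral>\<^sup>+ x. ennreal ((cmod (\<phi> x))\<^sup>2) * indicator (- {- real m..real m}) x \<partial>lborel)" for m
  have "e \<longlonglongrightarrow> (\<integral>\<^sup>+ x. 0 \<partial>(lborel :: real measure))"
    unfolding e_def
  proof (rule nn_integral_dominated_convergence[where w = "\<lambda>x. ennreal ((cmod (\<phi> x))\<^sup>2)"])
    show "(\<integral>\<^sup>+ x. ennreal ((cmod (\<phi> x))\<^sup>2) \<partial>lborel) < \<infinity>"
      using \<phi> by (simp add: L2_space_def L2_norm_sq_def)
    show "AE x in lborel. (\<lambda>m. ennreal ((cmod (\<phi> x))\<^sup>2) * indicator (- {- real m..real m}) x) \<longlonglongrightarrow> 0"
    proof (rule AE_I2)
      fix x :: real
      have "eventually (\<lambda>m. real m > \<bar>x\<bar>) sequentially"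
        using filterlim_real_sequentially by (rule filterlim_at_top_dense[THEN iffD1, rule_format])
      then have "eventually (\<lambda>m. ennreal ((cmod (\<phi> x))\<^sup>2) * indicator (- {- real m..real m}) x = 0) sequentially"
        by eventually_elim (auto simp: indicator_def)
      then show "(\<lambda>m. ennreal ((cmod (\<phi> x))\<^sup>2) * indicator (- {- real m..real m}) x) \<longlonglongrightarrow> 0"
        by (rule tendsto_eventually)
    qed
  qed (auto split: split_indicator)
  then have "e \<longlonglongrightarrow> 0" by simp
  then have e: "(\<lambda>m. ennreal (2 * pi) * e m) \<longlonglongrightarrow> 0"
    using ennreal_tendsto_cmult[of "ennreal (2 * pi)" e 0] by simp
  show ?thesis
  proof (rule L2_complete[OF _ e])
    fix m n :: nat assume "m \<le> n"
    define \<psi> where "\<psi> x = cutoff n \<phi> x - cutoff m \<phi> x" for x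
    \<comment> \<open>For \<open>m \<le> n\<close> the difference of the two cutoffs is
      \<open>\<phi>\<close> restricted to points of modulus above \<open>m\<close> and at most
      \<open>n\<close>.\<close>
    have le_e: "L2_norm_sq lborel \<psi> \<le> e m"
      unfolding L2_norm_sq_def e_def \<psi>_def cutoff_def
      by (rule nn_integral_mono) (use \<open>m \<le> n\<close> in \<open>auto split: split_indicator\<close>)
    have "e m \<le> L2_norm_sq lborel \<phi>"
      unfolding e_def L2_norm_sq_def by (rule nn_integral_mono) (auto split: split_indicator)
    with le_e \<phi> have \<psi>: "\<psi> \<in> L2_space lborel"
      by (auto simp: L2_space_def \<psi>_def[abs_def] intro: le_less_trans)
    have "L2_norm_sq lborel (fourier_int \<psi>) \<le> ennreal (2 * pi) * L2_norm_sq lborel \<psi>"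
    proof (rule plancherel_le[OF \<psi>])
      show "\<psi> x = 0" if "x \<notin> {- (real n + 1)..<- (real n + 1) + 2 * (real n + 1)}" for x
        using that \<open>m \<le> n\<close> by (auto simp: \<psi>_def cutoff_def indicator_def)
    qed simp
    also have "\<dots> \<le> ennreal (2 * pi) * e m" by (intro mult_left_mono le_e) simp
    finally show "L2_norm_sq lborel (\<lambda>x. fourier_int (cutoff n \<phi>) x - fourier_int (cutoff m \<phi>) x) \<le> ennreal (2 * pi) * e m"
      unfolding \<psi>_def by (simp add: fourier_int_diff[OF integrable_cutoff[OF \<phi>] integrable_cutoff[OF \<phi>], abs_def, symmetric])
  qed (use that in auto)
qed

lemma fourier_limit_in_L2:
  assumes \<phi>: "\<phi> \<in> L2_space lborel" and g: "g \<in> borel_measurable lborel"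
    and lim: "L2_tendsto lborel (\<lambda>N. fourier_int (cutoff N \<phi>)) g"
  shows "L2_norm_sq lborel g \<le> ennreal (2 * pi) * L2_norm_sq lborel \<phi>" "g \<in> L2_space lborel"
proof -
  have "fourier_int (cutoff N \<phi>) \<in> borel_measurable lborel" for N
    using cutoff_in_L2(1)[OF \<phi>, THEN L2_spaceD(1)] by simp
  then show "L2_norm_sq lborel g \<le> ennreal (2 * pi) * L2_norm_sq lborel \<phi>"
    by (rule L2_norm_sq_le_of_L2_tendsto[OF _ g lim plancherel_cutoff[OF \<phi>]])
  also have "\<dots> < \<infinity>"
    using \<phi> by (simp add: L2_space_def ennreal_mult_less_top)
  finally show "g \<in> L2_space lborel" using g by (simp add: L2_space_def)
qed

lemma L2_norm_sq_reflect:
  assumes [measurable]: "f \<in> borel_measurable borel"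
  shows "L2_norm_sq lborel (\<lambda>x. f (- x)) = L2_norm_sq lborel f"
  unfolding L2_norm_sq_def
  by (subst (2) nn_integral_real_affine[where c = "-1" and t = 0]) simp_all

text \<open>The \<open>SOME\<close> in the definition is discharged by exhibiting a limit: the limit
  for \<open>fourier_int\<close>, reflected because of the opposite sign in the exponent. The norm
  bound then passes to whichever representative was chosen.\<close>

lemma fourier_L2_props:
  assumes \<phi>: "\<phi> \<in> L2_space lborel"
  shows "fourier_L2 \<phi> \<in> L2_space lborel"
    and "L2_tendsto lborel (\<lambda>N \<xi>. fourier_int (cutoff N \<phi>) (- \<xi>)) (fourier_L2 \<phi>)"
    and "L2_norm_sq lborel (fourier_L2 \<phi>) \<le> ennreal (2 * pi) * L2_norm_sq lborel \<phi>"
proof -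
  have [measurable]: "cutoff N \<phi> \<in> borel_measurable borel" for N
    using cutoff_in_L2(1)[OF \<phi>, THEN L2_spaceD(1)] by simp
  have eq: "(LINT x:{- real N..real N}|lborel. cis (- (x * \<xi>)) * \<phi> x) = fourier_int (cutoff N \<phi>) (- \<xi>)" for N \<xi>
    unfolding set_lebesgue_integral_def fourier_int_def cutoff_def
    by (rule Bochner_Integration.integral_cong[OF refl]) (auto simp: indicator_def)
  obtain g where g [measurable]: "g \<in> borel_measurable lborel"
      and lim: "L2_tendsto lborel (\<lambda>N. fourier_int (cutoff N \<phi>)) g"
    by (rule fourier_int_cutoff_converges[OF \<phi>])
  have g_norm: "L2_norm_sq lborel (\<lambda>\<xi>. g (- \<xi>)) = L2_norm_sq lborel g"
    by (rule L2_norm_sq_reflect) (use g in simp)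
  have "L2_norm_sq lborel (\<lambda>\<xi>. fourier_int (cutoff N \<phi>) (- \<xi>) - g (- \<xi>))
      = L2_norm_sq lborel (\<lambda>\<xi>. fourier_int (cutoff N \<phi>) \<xi> - g \<xi>)" for N
    by (rule L2_norm_sq_reflect) (use g in measurable)
  then have "L2_tendsto lborel (\<lambda>N \<xi>. fourier_int (cutoff N \<phi>) (- \<xi>)) (\<lambda>\<xi>. g (- \<xi>))"
    using lim by (simp add: L2_tendsto_def)
  moreover have "(\<lambda>\<xi>. g (- \<xi>)) \<in> L2_space lborel"
    using fourier_limit_in_L2(2)[OF \<phi> g lim] g_norm g by (simp add: L2_space_def)
  ultimately have ex: "\<exists>g. g \<in> L2_space lborel \<and> L2_tendsto lborel (\<lambda>N \<xi>. fourier_int (cutoff N \<phi>) (- \<xi>)) g"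
    by blast
  from someI_ex[OF this]
  show L2: "fourier_L2 \<phi> \<in> L2_space lborel"
    and tends: "L2_tendsto lborel (\<lambda>N \<xi>. fourier_int (cutoff N \<phi>) (- \<xi>)) (fourier_L2 \<phi>)"
    by (simp_all add: fourier_L2_def eq)
  show "L2_norm_sq lborel (fourier_L2 \<phi>) \<le> ennreal (2 * pi) * L2_norm_sq lborel \<phi>"
  proof (rule L2_norm_sq_le_of_L2_tendsto[OF _ L2_spaceD(1)[OF L2] tends])
    fix N
    have "L2_norm_sq lborel (\<lambda>\<xi>. fourier_int (cutoff N \<phi>) (- \<xi>)) = L2_norm_sq lborel (fourier_int (cutoff N \<phi>))"
      by (rule L2_norm_sq_reflect) measurable
    then show "L2_norm_sq lborel (\<lambda>\<xi>. fourier_int (cutoff N \<phi>) (- \<xi>)) \<le> ennreal (2 * pi) * L2_norm_sq lborel \<phi>"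
      using plancherel_cutoff[OF \<phi>] by simp
  qed simp
qed

text \<open>The sign now agrees with \<open>fourier_int\<close>, so only the constant factor has to
  be carried through the limit.\<close>

lemma inv_fourier_L2_props:
  assumes h: "h \<in> L2_space lborel"
  shows "inv_fourier_L2 h \<in> L2_space lborel"
    and "L2_tendsto lborel (\<lambda>N x. fourier_int (cutoff N h) x / of_real (2 * pi)) (inv_fourier_L2 h)"
proof -
  have [measurable]: "cutoff N h \<in> borel_measurable borel" for N
    using cutoff_in_L2(1)[OF h, THEN L2_spaceD(1)] by simp
  have eq: "(LINT \<xi>:{- real N..real N}|lborel. cis (x * \<xi>) * h \<xi>) = fourier_int (cutoff N h) x" for N x
    unfolding set_lebesgue_integral_def fourier_int_def cutoff_def
    by (rule Bochner_Integration.integral_cong[OF refl]) (auto simp: indicator_def mult.commute)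
  obtain g where g [measurable]: "g \<in> borel_measurable lborel"
      and lim: "L2_tendsto lborel (\<lambda>N. fourier_int (cutoff N h)) g"
    by (rule fourier_int_cutoff_converges[OF h])
  define c where "c = 1 / complex_of_real (2 * pi)"
  have "L2_norm_sq lborel (\<lambda>x. c * (fourier_int (cutoff N h) x - g x))
      = ennreal ((cmod c)\<^sup>2) * L2_norm_sq lborel (\<lambda>x. fourier_int (cutoff N h) x - g x)" for N
    by (rule L2_norm_sq_cmult) measurable
  moreover have "(\<lambda>N. ennreal ((cmod c)\<^sup>2) * L2_norm_sq lborel (\<lambda>x. fourier_int (cutoff N h) x - g x)) \<longlonglongrightarrow> ennreal ((cmod c)\<^sup>2) * 0"
    using lim unfolding L2_tendsto_def by (intro ennreal_tendsto_cmult) simp_all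
  ultimately have "L2_tendsto lborel (\<lambda>N x. fourier_int (cutoff N h) x / of_real (2 * pi)) (\<lambda>x. c * g x)"
    by (simp add: L2_tendsto_def c_def diff_divide_distrib)
  moreover have "(\<lambda>x. c * g x) \<in> L2_space lborel"
    using fourier_limit_in_L2(2)[OF h g lim] L2_norm_sq_cmult[OF g, of c]
    by (auto simp: L2_space_def ennreal_mult_less_top)
  ultimately have ex: "\<exists>g. g \<in> L2_space lborel \<and>
      L2_tendsto lborel (\<lambda>N x. fourier_int (cutoff N h) x / of_real (2 * pi)) g"
    by blast
  from someI_ex[OF this]
  show "inv_fourier_L2 h \<in> L2_space lborel"
    and "L2_tendsto lborel (\<lambda>N x. fourier_int (cutoff N h) x / of_real (2 * pi)) (inv_fourier_L2 h)"
    by (simp_all add: inv_fourier_L2_def eq)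
qed

text \<open>This is the solution with frequency profile \<open>h\<close> as an absolutely convergent
  integral when \<open>h\<close> is integrable. The profiles used below are either cut off to
  bounded frequencies or Gaussian.\<close>

definition free_wave :: "(real \<Rightarrow> complex) \<Rightarrow> real \<Rightarrow> real \<Rightarrow> complex" where
  "free_wave h r x = fourier_int (\<lambda>\<xi>. cis (- (r * \<xi>\<^sup>2)) * h \<xi>) x / of_real (2 * pi)"

lemma measurable_free_wave [measurable]:
  assumes [measurable]: "h \<in> borel_measurable borel"
  shows "(\<lambda>(r, x). free_wave h r x) \<in> borel_measurable (borel \<Otimes>\<^sub>M borel)"
  unfolding free_wave_def fourier_int_def by measurable

lemma modulated_in_L2:
  assumes "h \<in> L2_space lborel"
  shows "(\<lambda>\<xi>. cis (- (r * \<xi>\<^sup>2)) * h \<xi>) \<in> L2_space lborel"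
proof -
  have [measurable]: "h \<in> borel_measurable borel" using L2_spaceD(1)[OF assms] by simp
  have "L2_norm_sq lborel (\<lambda>\<xi>. cis (- (r * \<xi>\<^sup>2)) * h \<xi>) = L2_norm_sq lborel h"
    by (simp add: L2_norm_sq_def norm_mult)
  then show ?thesis using assms by (simp add: L2_space_def)
qed

text \<open>Truncation in frequency commutes with the multiplier, so the truncated inverse
  transforms that define the propagator are free waves with truncated profiles, the truncation being
  the same for every \<open>r\<close>.\<close>

lemma schrodinger_line_props:
  assumes \<phi>: "\<phi> \<in> L2_space lborel"
  shows "schrodinger_line r \<phi> \<in> borel_measurable lborel"
    and "L2_tendsto lborel (\<lambda>N. free_wave (cutoff N (fourier_L2 \<phi>)) r) (schrodinger_line r \<phi>)"
proof -
  let ?h = "\<lambda>\<xi>. cis (- (r * \<xi>\<^sup>2)) * fourier_L2 \<phi> \<xi>"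
  have h: "?h \<in> L2_space lborel"
    by (rule modulated_in_L2[OF fourier_L2_props(1)[OF \<phi>]])
  show "schrodinger_line r \<phi> \<in> borel_measurable lborel"
    unfolding schrodinger_line_def by (rule L2_spaceD(1)[OF inv_fourier_L2_props(1)[OF h]])
  have "cutoff N ?h = (\<lambda>\<xi>. cis (- (r * \<xi>\<^sup>2)) * cutoff N (fourier_L2 \<phi>) \<xi>)" for N
    by (simp add: cutoff_def fun_eq_iff mult_ac)
  then show "L2_tendsto lborel (\<lambda>N. free_wave (cutoff N (fourier_L2 \<phi>)) r) (schrodinger_line r \<phi>)"
    using inv_fourier_L2_props(2)[OF h] unfolding schrodinger_line_def free_wave_def[abs_def] by simp
qed

section \<open>Lower semicontinuity of the space-time L4 integral\<close>

definition L4_norm4 :: "real measure \<Rightarrow> (real \<Rightarrow> complex) \<Rightarrow> ennreal" where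
  "L4_norm4 M f = (\<integral>\<^sup>+ x. ennreal ((cmod (f x)) ^ 4) \<partial>M)"

text \<open>Along a subsequence realising the lower limit, a further subsequence converges almost
  everywhere, and Fatou's lemma applies to it.\<close>

lemma L4_norm4_le_liminf:
  assumes F [measurable]: "\<And>n. F n \<in> borel_measurable M" and g [measurable]: "g \<in> borel_measurable M"
    and lim: "L2_tendsto M F g"
  shows "L4_norm4 M g \<le> liminf (\<lambda>n. L4_norm4 M (F n))"
proof -
  obtain s where s: "strict_mono s" "((\<lambda>n. L4_norm4 M (F n)) \<circ> s) \<longlonglongrightarrow> liminf (\<lambda>n. L4_norm4 M (F n))"
    using liminf_subseq_lim by blast
  have "L2_tendsto M (\<lambda>n. F (s n)) g"
    using LIMSEQ_subseq_LIMSEQ[OF lim[unfolded L2_tendsto_def] s(1)] by (simp add: L2_tendsto_def o_def)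
  then obtain t where t: "strict_mono t" "AE x in M. (\<lambda>n. F (s (t n)) x) \<longlonglongrightarrow> g x"
    by (rule L2_tendsto_AE_subseq[rotated 2]) measurable
  have "L4_norm4 M g = (\<integral>\<^sup>+ x. liminf (\<lambda>n. ennreal ((cmod (F (s (t n)) x)) ^ 4)) \<partial>M)"
    unfolding L4_norm4_def
  proof (rule nn_integral_cong_AE, use t(2) in eventually_elim)
    fix x assume "(\<lambda>n. F (s (t n)) x) \<longlonglongrightarrow> g x"
    then have "(\<lambda>n. ennreal ((cmod (F (s (t n)) x)) ^ 4)) \<longlonglongrightarrow> ennreal ((cmod (g x)) ^ 4)"
      by (intro tendsto_ennrealI tendsto_intros)
    then show "ennreal ((cmod (g x)) ^ 4) = liminf (\<lambda>n. ennreal ((cmod (F (s (t n)) x)) ^ 4))"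
      by (rule lim_imp_Liminf[OF sequentially_bot, symmetric])
  qed
  also have "\<dots> \<le> liminf (\<lambda>n. L4_norm4 M (F (s (t n))))"
    unfolding L4_norm4_def by (rule nn_integral_liminf) measurable
  also have "\<dots> = liminf (\<lambda>n. L4_norm4 M (F n))"
    using LIMSEQ_subseq_LIMSEQ[OF s(2) t(1)]
    by (intro lim_imp_Liminf[OF sequentially_bot]) (simp add: o_def)
  finally show ?thesis .
qed

lemma measurable_L4_norm4_free_wave [measurable]:
  assumes [measurable]: "h \<in> borel_measurable borel"
  shows "(\<lambda>r. L4_norm4 lborel (free_wave h r)) \<in> borel_measurable borel"
  unfolding L4_norm4_def by measurable

text \<open>At each time the chosen representative is compared with the free waves by lower
  semicontinuity; monotonicity carries this under the time integral, and Fatou's lemma in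
  \<open>r\<close> is applied to the free waves, whose L4 integrals are measurable in
  \<open>r\<close>.\<close>

lemma schrodinger_line_L4_le_liminf:
  assumes \<phi>: "\<phi> \<in> L2_space lborel"
  shows "(\<integral>\<^sup>+ r\<in>{0..1}. L4_norm4 lborel (schrodinger_line r \<phi>) \<partial>lborel)
    \<le> liminf (\<lambda>N. \<integral>\<^sup>+ r\<in>{0..1}. L4_norm4 lborel (free_wave (cutoff N (fourier_L2 \<phi>)) r) \<partial>lborel)"
proof -
  let ?u = "\<lambda>N. free_wave (cutoff N (fourier_L2 \<phi>))"
  have [measurable]: "cutoff N (fourier_L2 \<phi>) \<in> borel_measurable borel" for N
    using L2_spaceD(1)[OF cutoff_in_L2(1)[OF fourier_L2_props(1)[OF \<phi>]]] by simp
  have [measurable]: "?u N r \<in> borel_measurable borel" for N r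
    using measurable_compose[OF measurable_Pair1'[of r borel borel] measurable_free_wave] by simp
  have le: "L4_norm4 lborel (schrodinger_line r \<phi>) \<le> liminf (\<lambda>N. L4_norm4 lborel (?u N r))" for r
    by (rule L4_norm4_le_liminf[OF _ schrodinger_line_props[OF \<phi>]]) simp
  have "(\<integral>\<^sup>+ r\<in>{0..1}. L4_norm4 lborel (schrodinger_line r \<phi>) \<partial>lborel)
      \<le> (\<integral>\<^sup>+ r. liminf (\<lambda>N. L4_norm4 lborel (?u N r) * indicator {0..1} r) \<partial>lborel)"
    by (rule nn_integral_mono) (use le in \<open>auto split: split_indicator\<close>)
  also have "\<dots> \<le> liminf (\<lambda>N. \<integral>\<^sup>+ r\<in>{0..1}. L4_norm4 lborel (?u N r) \<partial>lborel)"
    by (rule nn_integral_liminf) measurable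
  finally show ?thesis .
qed

section \<open>Trigonometric polynomials on the torus\<close>

definition trig_wave :: "real \<Rightarrow> int set \<Rightarrow> (int \<Rightarrow> complex) \<Rightarrow> real \<Rightarrow> real \<Rightarrow> complex" where
  "trig_wave L K b r x = (\<Sum>k\<in>K. cis (- (r * (2 * pi * of_int k / L)\<^sup>2)) * b k * cis (2 * pi * of_int k / L * x))"

lemma measurable_trig_wave [measurable]:
  "(\<lambda>(r, x). trig_wave L K b r x) \<in> borel_measurable (borel \<Otimes>\<^sub>M borel)"
  unfolding trig_wave_def by measurable

lemma measurable_trig_wave_torus:
  "trig_wave L K b r \<in> borel_measurable (torus_measure L)"
  unfolding torus_measure_def trig_wave_def[abs_def] by (rule measurable_restrict_space1) measurable

lemma trig_wave_0: "trig_wave L K b 0 x = (\<Sum>k\<in>K. b k * cis (2 * pi * of_int k / L * x))"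
  by (simp add: trig_wave_def)

lemma L2_norm_sq_trig_wave:
  assumes "L > 0" "finite K"
  shows "L2_norm_sq (torus_measure L) (trig_wave L K b r) = ennreal (L * (\<Sum>k\<in>K. (cmod (b k))\<^sup>2))"
proof -
  let ?b = "\<lambda>k. cis (- (r * (2 * pi * of_int k / L)\<^sup>2)) * b k"
  let ?g = "\<lambda>x. (cmod (trig_wave L K b r x))\<^sup>2"
  interpret finite_measure "torus_measure L"
    unfolding torus_measure_def by (rule finite_measure_interval)
  have "cmod (trig_wave L K b r x) \<le> (\<Sum>k\<in>K. cmod (b k))" for x
    unfolding trig_wave_def by (rule order_trans[OF norm_sum]) (simp add: norm_mult)
  then have bd: "?g x \<le> (\<Sum>k\<in>K. cmod (b k))\<^sup>2" for x
    by (intro power_mono) simp_all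
  have "integrable (torus_measure L) ?g"
    by (rule integrable_const_bound[where B = "(\<Sum>k\<in>K. cmod (b k))\<^sup>2"])
      (use bd measurable_trig_wave_torus in auto)
  then have "L2_norm_sq (torus_measure L) (trig_wave L K b r) = ennreal (LINT x|torus_measure L. ?g x)"
    unfolding L2_norm_sq_def by (rule nn_integral_eq_integral) simp
  also have "(LINT x|torus_measure L. ?g x) = L * (\<Sum>k\<in>K. (cmod (?b k))\<^sup>2)"
    using integral_norm_sq_trig_sum[OF assms, of 0 ?b] by (simp add: torus_measure_def trig_wave_def)
  finally show ?thesis by (simp add: norm_mult)
qed

lemma trig_wave_in_L2_torus:
  assumes "L > 0" "finite K"
  shows "trig_wave L K b r \<in> L2_torus L"
proof -
  have "cis (2 * pi * of_int k / L * (x + L)) = cis (2 * pi * of_int k / L * x)" for k x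
  proof -
    have "2 * pi * of_int k / L * (x + L) = 2 * pi * of_int k / L * x + 2 * pi * of_int k"
      using assms by (simp add: field_simps)
    then show ?thesis by (simp only: cis_mult[symmetric]) (simp add: cis_multiple_2pi)
  qed
  then show ?thesis
    using L2_norm_sq_trig_wave[OF assms] measurable_trig_wave_torus
    by (simp add: L2_torus_def L2_space_def trig_wave_def)
qed

lemma fourier_coeff_trig_wave:
  assumes "L > 0" "finite K"
  shows "fourier_coeff L (trig_wave L K b 0) k = (if k \<in> K then b k else 0)"
proof -
  let ?e = "\<lambda>k x. cis (2 * pi * of_int k / L * x)"
  interpret finite_measure "torus_measure L"
    unfolding torus_measure_def by (rule finite_measure_interval)
  have int: "integrable (torus_measure L) (\<lambda>x. b j * (?e j x * cnj (?e k x)))" for j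
    by (rule integrable_mult_right, rule integrable_const_bound[where B = 1])
      (auto simp: norm_mult torus_measure_def intro!: measurable_restrict_space1)
  have "(LINT x|torus_measure L. cis (- (2 * pi * of_int k / L * x)) * trig_wave L K b 0 x)
      = (LINT x|torus_measure L. (\<Sum>j\<in>K. b j * (?e j x * cnj (?e k x))))"
    by (rule Bochner_Integration.integral_cong[OF refl])
      (simp add: trig_wave_0 sum_distrib_left mult_ac cis_cnj)
  also have "\<dots> = (\<Sum>j\<in>K. b j * (if j = k then of_real L else 0))"
    by (simp only: Bochner_Integration.integral_sum int integral_mult_right_zero
        integral_cis_orthogonal[OF assms(1), of 0, unfolded add_0, folded torus_measure_def])
  also have "\<dots> = (if k \<in> K then b k * of_real L else 0)"
    using assms(2) by (simp add: if_distrib sum.delta cong: if_cong)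
  finally show ?thesis
    using assms(1) by (simp add: fourier_coeff_def)
qed

text \<open>The symmetric frequency range matches the partial sums in
  \<open>schrodinger_torus\<close>: from index \<open>M\<close> on they equal the evolved polynomial
  exactly. The representative picked by \<open>SOME\<close> can differ from it only on a null
  set.\<close>

lemma schrodinger_torus_trig_wave:
  assumes L: "L > 0"
  shows "AE x in torus_measure L. schrodinger_torus L r (trig_wave L {-int M..int M} b 0) x
    = trig_wave L {-int M..int M} b r x"
proof -
  let ?K = "{-int M..int M}"
  define S where "S N x = (\<Sum>k\<in>{- int N..int N}.
          cis (- (r * (2 * pi * of_int k / L)\<^sup>2)) * fourier_coeff L (trig_wave L ?K b 0) k
            * cis (2 * pi * of_int k / L * x))" for N x
  have S_eq: "S N = trig_wave L ?K b r" if "N \<ge> M" for N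
  proof
    fix x
    show "S N x = trig_wave L ?K b r x"
      unfolding S_def trig_wave_def fourier_coeff_trig_wave[OF L finite_atLeastAtMost_int]
      by (rule sum.mono_neutral_cong_right) (use that in auto)
  qed
  have S_m: "S N \<in> borel_measurable (torus_measure L)" for N
    unfolding S_def[abs_def] torus_measure_def by (rule measurable_restrict_space1) measurable
  have "eventually (\<lambda>N. L2_norm_sq (torus_measure L) (\<lambda>x. S N x - trig_wave L ?K b r x) = 0) sequentially"
    using eventually_ge_at_top[of M] by eventually_elim (simp add: S_eq L2_norm_sq_def)
  then have "L2_tendsto (torus_measure L) S (trig_wave L ?K b r)"
    unfolding L2_tendsto_def by (rule tendsto_eventually)
  then have "\<exists>g. g \<in> L2_torus L \<and> L2_tendsto (torus_measure L) S g"
    using trig_wave_in_L2_torus[OF L finite_atLeastAtMost_int] by blast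
  from someI_ex[OF this]
  have "schrodinger_torus L r (trig_wave L ?K b 0) \<in> L2_torus L"
    and lim: "L2_tendsto (torus_measure L) S (schrodinger_torus L r (trig_wave L ?K b 0))"
    unfolding schrodinger_torus_def S_def[abs_def] by simp_all
  then have m: "schrodinger_torus L r (trig_wave L ?K b 0) \<in> borel_measurable (torus_measure L)"
    by (simp add: L2_torus_def L2_space_def)
  have "(\<lambda>N. S N x) \<longlonglongrightarrow> trig_wave L ?K b r x" for x
    by (rule tendsto_eventually, use eventually_ge_at_top[of M] in eventually_elim) (simp add: S_eq)
  then show ?thesis
    by (rule L2_tendsto_AE_eq[OF S_m m lim])
qed

section \<open>Trigonometric polynomials as competitors for \<open>omega1\<close>\<close>

lemma L4_norm4_cong_AE:
  "AE x in M. f x = g x \<Longrightarrow> L4_norm4 M f = L4_norm4 M g"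
  unfolding L4_norm4_def by (intro nn_integral_cong_AE) auto

lemma trig_wave_L4_le_omega1_normalized:
  assumes L: "L > 0" and norm: "L * (\<Sum>k\<in>{-int M..int M}. (cmod (b k))\<^sup>2) = 1"
  shows "(\<integral>\<^sup>+ r\<in>{0..1}. L4_norm4 (torus_measure L) (trig_wave L {-int M..int M} b r) \<partial>lborel) \<le> omega1 L"
proof -
  let ?f = "trig_wave L {-int M..int M} b"
  have "L4_norm4 (torus_measure L) (schrodinger_torus L r (?f 0)) = L4_norm4 (torus_measure L) (?f r)" for r
    by (rule L4_norm4_cong_AE[OF schrodinger_torus_trig_wave[OF L]])
  then have "(\<integral>\<^sup>+ r\<in>{0..1}. L4_norm4 (torus_measure L) (?f r) \<partial>lborel)
      = (\<integral>\<^sup>+ r\<in>{0..1}. L4_norm4 (torus_measure L) (schrodinger_torus L r (?f 0)) \<partial>lborel)"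
    by simp
  also have "\<dots> \<le> omega1 L"
    unfolding omega1_def L4_norm4_def
    by (rule SUP_upper) (use trig_wave_in_L2_torus[OF L] L2_norm_sq_trig_wave[OF L] norm in simp)
  finally show ?thesis .
qed

text \<open>Dividing by \<open>sqrt s\<close> normalises the data, and since
  \<open>s \<le> 1\<close> this can only increase the wave. For \<open>s = 0\<close> the wave
  vanishes and the bound is trivial.\<close>

lemma trig_wave_L4_le_omega1:
  assumes L: "L > 0" and norm: "L * (\<Sum>k\<in>{-int M..int M}. (cmod (b k))\<^sup>2) \<le> 1"
  shows "(\<integral>\<^sup>+ r\<in>{0..1}. L4_norm4 (torus_measure L) (trig_wave L {-int M..int M} b r) \<partial>lborel) \<le> omega1 L"
proof -
  let ?K = "{-int M..int M}"
  define s where "s = L * (\<Sum>k\<in>?K. (cmod (b k))\<^sup>2)"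
  have s: "0 \<le> s" "s \<le> 1" using L norm by (auto simp: s_def intro!: mult_nonneg_nonneg sum_nonneg)
  show ?thesis
  proof (cases "s = 0")
    case True
    then have "(\<Sum>k\<in>?K. (cmod (b k))\<^sup>2) = 0" using L by (simp add: s_def)
    then have "\<forall>k\<in>?K. b k = 0" by (subst (asm) sum_nonneg_eq_0_iff) auto
    then have "trig_wave L ?K b r x = 0" for r x by (simp add: trig_wave_def)
    then show ?thesis by (simp add: L4_norm4_def)
  next
    case False
    define c where "c k = b k / of_real (sqrt s)" for k
    have wave: "trig_wave L ?K b r x = of_real (sqrt s) * trig_wave L ?K c r x" for r x
      using False by (simp add: trig_wave_def c_def sum_distrib_left)
    have "cmod (trig_wave L ?K b r x) \<le> cmod (trig_wave L ?K c r x)" for r x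
      unfolding wave norm_mult using s by (intro mult_left_le_one_le) (simp_all add: abs_le_iff)
    then have "L4_norm4 (torus_measure L) (trig_wave L ?K b r) \<le> L4_norm4 (torus_measure L) (trig_wave L ?K c r)" for r
      unfolding L4_norm4_def by (intro nn_integral_mono ennreal_leI power_mono) auto
    then have "(\<integral>\<^sup>+ r\<in>{0..1}. L4_norm4 (torus_measure L) (trig_wave L ?K b r) \<partial>lborel)
        \<le> (\<integral>\<^sup>+ r\<in>{0..1}. L4_norm4 (torus_measure L) (trig_wave L ?K c r) \<partial>lborel)"
      by (intro nn_integral_mono mult_right_mono) auto
    also have "\<dots> \<le> omega1 L"
    proof (rule trig_wave_L4_le_omega1_normalized[OF L])
      have "L * (\<Sum>k\<in>?K. (cmod (c k))\<^sup>2) = L * (\<Sum>k\<in>?K. (cmod (b k))\<^sup>2) / s"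
        using s by (simp add: c_def norm_divide power_divide sum_divide_distrib[symmetric])
      then show "L * (\<Sum>k\<in>?K. (cmod (c k))\<^sup>2) = 1" using False by (simp add: s_def)
    qed
    finally show ?thesis .
  qed
qed

section \<open>Transference from the line to the torus\<close>

text \<open>As fibres of a floor function the cells visibly partition the line, and the index of the
  cell of \<open>\<xi>\<close> is an explicit measurable function of \<open>\<xi>\<close>.\<close>

definition cell :: "real \<Rightarrow> int \<Rightarrow> real set" where
  "cell L k = {\<xi>. \<lfloor>\<xi> * L / (2 * pi)\<rfloor> = k}"

text \<open>Integrating over a cell, and not sampling, makes sense for a profile known only almost
  everywhere. The factor \<open>1 / (2 * pi)\<close> is the one in \<open>free_wave\<close>.\<close>

definition cell_coeff :: "(real \<Rightarrow> complex) \<Rightarrow> real \<Rightarrow> int \<Rightarrow> complex" where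
  "cell_coeff h L k = (LINT \<xi>|lborel. indicator (cell L k) \<xi> *\<^sub>R h \<xi>) / of_real (2 * pi)"

lemma cell_eq:
  assumes "L > 0"
  shows "cell L k = {2 * pi * of_int k / L..<2 * pi * of_int k / L + 2 * pi / L}"
proof -
  have "of_int k \<le> \<xi> * L / (2 * pi) \<longleftrightarrow> 2 * pi * of_int k / L \<le> \<xi>" for \<xi>
    using assms by (simp add: field_simps)
  moreover have "\<xi> * L / (2 * pi) < of_int k + 1 \<longleftrightarrow> \<xi> < 2 * pi * of_int k / L + 2 * pi / L" for \<xi>
    using assms by (simp add: field_simps)
  ultimately show ?thesis by (auto simp: cell_def floor_eq_iff)
qed

lemma measurable_cell [measurable]: "cell L k \<in> sets borel"
  unfolding cell_def by measurable

lemma sum_integral_cells: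
  fixes g :: "real \<Rightarrow> 'b::{banach, second_countable_topology}"
  assumes g: "integrable lborel g" and K: "finite K" and supp: "\<And>\<xi>. g \<xi> \<noteq> 0 \<Longrightarrow> \<lfloor>\<xi> * L / (2 * pi)\<rfloor> \<in> K"
  shows "(\<Sum>k\<in>K. LINT \<xi>|lborel. indicator (cell L k) \<xi> *\<^sub>R g \<xi>) = (LINT \<xi>|lborel. g \<xi>)"
proof -
  have "(\<Sum>k\<in>K. LINT \<xi>|lborel. indicator (cell L k) \<xi> *\<^sub>R g \<xi>) = (LINT \<xi>|lborel. (\<Sum>k\<in>K. indicator (cell L k) \<xi> *\<^sub>R g \<xi>))"
    by (rule Bochner_Integration.integral_sum[symmetric]) (intro integrable_mult_indicator g, simp)
  also have "\<dots> = (LINT \<xi>|lborel. g \<xi>)"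
  proof (rule Bochner_Integration.integral_cong[OF refl])
    fix \<xi>
    have "(\<Sum>k\<in>K. indicator (cell L k) \<xi> *\<^sub>R g \<xi>) = (\<Sum>k\<in>K. if \<lfloor>\<xi> * L / (2 * pi)\<rfloor> = k then g \<xi> else 0)"
      by (rule sum.cong[OF refl]) (simp add: cell_def indicator_def)
    also have "\<dots> = g \<xi>" using K supp by (auto simp: sum.delta)
    finally show "(\<Sum>k\<in>K. indicator (cell L k) \<xi> *\<^sub>R g \<xi>) = g \<xi>" .
  qed
  finally show ?thesis .
qed

text \<open>Cauchy-Schwarz on one cell costs its length \<open>2 * pi / L\<close>. With the torus
  weight \<open>L\<close> and the squared factor \<open>1 / (2 * pi)\<close> of the coefficient,
  exactly \<open>1 / (2 * pi)\<close> remains.\<close>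

lemma cell_coeff_sq_le:
  assumes h: "h \<in> L2_space lborel" and int: "integrable lborel h" and L: "L > 0"
  shows "L * (cmod (cell_coeff h L k))\<^sup>2 \<le> (LINT \<xi>|lborel. indicator (cell L k) \<xi> *\<^sub>R (cmod (h \<xi>))\<^sup>2) / (2 * pi)"
proof -
  let ?a = "2 * pi * of_int k / L" and ?l = "2 * pi / L"
  have l: "?l > 0" using L by simp
  have cell: "cell L k = {?a..<?a + ?l}" by (rule cell_eq[OF L])
  have i1: "integrable (restrict_space lborel {?a..<?a + ?l}) h"
    by (subst integrable_restrict_space) (simp_all add: integrable_mult_indicator int)
  have i2: "integrable (restrict_space lborel {?a..<?a + ?l}) (\<lambda>x. (cmod (h x))\<^sup>2)"
    by (subst integrable_restrict_space)
      (simp_all add: integrable_mult_indicator L2_spaceD(2)[OF h] del: real_scaleR_def)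
  have "(cmod (LINT x|restrict_space lborel {?a..<?a + ?l}. h x))\<^sup>2
      \<le> ?l * (LINT x|restrict_space lborel {?a..<?a + ?l}. (cmod (h x))\<^sup>2)"
    \<comment> \<open>Bessel with the single frequency 0 is Cauchy-Schwarz on the cell.\<close>
    using bessel_inequality[OF l _ i1 i2, of "{0}"] by simp
  then have "(cmod (LINT \<xi>|lborel. indicator (cell L k) \<xi> *\<^sub>R h \<xi>))\<^sup>2
      \<le> ?l * (LINT \<xi>|lborel. indicator (cell L k) \<xi> *\<^sub>R (cmod (h \<xi>))\<^sup>2)"
    unfolding cell by (subst (asm) (1 2) integral_restrict_space) simp_all
  then have "L * ((cmod (LINT \<xi>|lborel. indicator (cell L k) \<xi> *\<^sub>R h \<xi>))\<^sup>2 / (2 * pi)\<^sup>2)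
      \<le> L * (?l * (LINT \<xi>|lborel. indicator (cell L k) \<xi> *\<^sub>R (cmod (h \<xi>))\<^sup>2) / (2 * pi)\<^sup>2)"
    using L by (intro mult_left_mono divide_right_mono) simp_all
  also have "\<dots> = (LINT \<xi>|lborel. indicator (cell L k) \<xi> *\<^sub>R (cmod (h \<xi>))\<^sup>2) / (2 * pi)"
    using L by (simp add: power2_eq_square)
  finally show ?thesis
    by (simp add: cell_coeff_def norm_divide power_divide norm_mult power_mult_distrib)
qed

lemma sum_cell_coeff_sq_le:
  assumes h: "h \<in> L2_space lborel" and int: "integrable lborel h" and L: "L > 0"
    and norm: "L2_norm_sq lborel h \<le> ennreal (2 * pi)"
    and K: "finite K" and supp: "\<And>\<xi>. h \<xi> \<noteq> 0 \<Longrightarrow> \<lfloor>\<xi> * L / (2 * pi)\<rfloor> \<in> K"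
  shows "L * (\<Sum>k\<in>K. (cmod (cell_coeff h L k))\<^sup>2) \<le> 1"
proof -
  have "L * (\<Sum>k\<in>K. (cmod (cell_coeff h L k))\<^sup>2)
      \<le> (\<Sum>k\<in>K. (LINT \<xi>|lborel. indicator (cell L k) \<xi> *\<^sub>R (cmod (h \<xi>))\<^sup>2) / (2 * pi))"
    unfolding sum_distrib_left by (intro sum_mono cell_coeff_sq_le h int L)
  also have "\<dots> = (LINT \<xi>|lborel. (cmod (h \<xi>))\<^sup>2) / (2 * pi)"
    unfolding sum_divide_distrib[symmetric]
    by (subst sum_integral_cells[OF L2_spaceD(2)[OF h] K]) (use supp in auto)
  \<comment> \<open>The Plancherel constant \<open>2 * pi\<close> in the norm of \<open>h\<close>
    cancels the denominator.\<close>
  also have "\<dots> \<le> 1"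
    using norm by (simp add: L2_spaceD(3)[OF h])
  finally show ?thesis .
qed

text \<open>Here \<open>q\<close> rounds a frequency down to the lattice. On a cell the phase at the
  lattice point is the phase at \<open>q \<xi>\<close>, so the sum over cells becomes one integral
  of \<open>h\<close> against a rounded phase.\<close>

lemma trig_wave_cell_coeff:
  assumes int: "integrable lborel h"
    and K: "finite K" and supp: "\<And>\<xi>. h \<xi> \<noteq> 0 \<Longrightarrow> \<lfloor>\<xi> * L / (2 * pi)\<rfloor> \<in> K"
  defines "q \<equiv> \<lambda>\<xi>. 2 * pi * of_int \<lfloor>\<xi> * L / (2 * pi)\<rfloor> / L"
  shows "trig_wave L K (cell_coeff h L) r y =
    (LINT \<xi>|lborel. cis (q \<xi> * y - r * (q \<xi>)\<^sup>2) * h \<xi>) / of_real (2 * pi)"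
proof -
  let ?E = "\<lambda>k. cis (2 * pi * of_int k / L * y - r * (2 * pi * of_int k / L)\<^sup>2)"
  let ?g = "\<lambda>\<xi>. cis (q \<xi> * y - r * (q \<xi>)\<^sup>2) * h \<xi>"
  have "trig_wave L K (cell_coeff h L) r y = (\<Sum>k\<in>K. ?E k * cell_coeff h L k)"
    unfolding trig_wave_def
  proof (rule sum.cong[OF refl])
    fix k
    have "?E k = cis (- (r * (2 * pi * of_int k / L)\<^sup>2)) * cis (2 * pi * of_int k / L * y)"
      unfolding cis_mult by (simp add: algebra_simps)
    then show "cis (- (r * (2 * pi * of_int k / L)\<^sup>2)) * cell_coeff h L k * cis (2 * pi * of_int k / L * y)
        = ?E k * cell_coeff h L k"
      by (simp only: mult_ac)
  qed
  also have "\<dots> = (\<Sum>k\<in>K. ?E k * (LINT \<xi>|lborel. indicator (cell L k) \<xi> *\<^sub>R h \<xi>)) / of_real (2 * pi)"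
    by (simp add: cell_coeff_def sum_divide_distrib)
  also have "(\<Sum>k\<in>K. ?E k * (LINT \<xi>|lborel. indicator (cell L k) \<xi> *\<^sub>R h \<xi>))
      = (\<Sum>k\<in>K. LINT \<xi>|lborel. indicator (cell L k) \<xi> *\<^sub>R ?g \<xi>)"
  proof (rule sum.cong[OF refl])
    fix k
    have "?E k * (LINT \<xi>|lborel. indicator (cell L k) \<xi> *\<^sub>R h \<xi>) = (LINT \<xi>|lborel. ?E k * (indicator (cell L k) \<xi> *\<^sub>R h \<xi>))"
      by (rule integral_mult_right_zero[symmetric])
    also have "\<dots> = (LINT \<xi>|lborel. indicator (cell L k) \<xi> *\<^sub>R ?g \<xi>)"
      by (rule Bochner_Integration.integral_cong[OF refl]) (auto simp: cell_def q_def indicator_def)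
    finally show "?E k * (LINT \<xi>|lborel. indicator (cell L k) \<xi> *\<^sub>R h \<xi>) = (LINT \<xi>|lborel. indicator (cell L k) \<xi> *\<^sub>R ?g \<xi>)" .
  qed
  also have "\<dots> = (LINT \<xi>|lborel. ?g \<xi>)"
  proof (rule sum_integral_cells[OF _ K])
    show "integrable lborel ?g"
      by (rule integrable_cis_mult[OF _ int]) (unfold q_def, measurable)
  qed (use supp in auto)
  finally show ?thesis .
qed

text \<open>The rounding error is at most \<open>2 * pi / L j\<close>, so the rounded phases
  converge for every frequency, and the modulus of \<open>h\<close> dominates the
  integrands.\<close>

lemma trig_wave_cell_coeff_tendsto:
  assumes int: "integrable lborel h"
    and L: "\<And>j. L j > 0" "filterlim L at_top sequentially"
    and K: "\<And>j. finite (K j)" and supp: "\<And>j \<xi>. h \<xi> \<noteq> 0 \<Longrightarrow> \<lfloor>\<xi> * L j / (2 * pi)\<rfloor> \<in> K j"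
  shows "(\<lambda>j. trig_wave (L j) (K j) (cell_coeff h (L j)) r y) \<longlonglongrightarrow> free_wave h r y"
proof -
  define q where "q j \<xi> = 2 * pi * of_int \<lfloor>\<xi> * L j / (2 * pi)\<rfloor> / L j" for j \<xi>
  have q: "(\<lambda>j. q j \<xi>) \<longlonglongrightarrow> \<xi>" for \<xi>
  proof (rule Lim_null_comparison[THEN LIM_zero_cancel])
    have "norm (q j \<xi> - \<xi>) \<le> 2 * pi / L j" for j
    proof -
      have "\<bar>of_int \<lfloor>\<xi> * L j / (2 * pi)\<rfloor> - \<xi> * L j / (2 * pi)\<bar> \<le> 1" by linarith
      then have "2 * pi / L j * \<bar>of_int \<lfloor>\<xi> * L j / (2 * pi)\<rfloor> - \<xi> * L j / (2 * pi)\<bar> \<le> 2 * pi / L j * 1"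
        using L(1)[of j] by (intro mult_left_mono) simp_all
      moreover have "2 * pi / L j * \<bar>of_int \<lfloor>\<xi> * L j / (2 * pi)\<rfloor> - \<xi> * L j / (2 * pi)\<bar> = \<bar>q j \<xi> - \<xi>\<bar>"
      proof -
        have "2 * pi / L j * \<bar>of_int \<lfloor>\<xi> * L j / (2 * pi)\<rfloor> - \<xi> * L j / (2 * pi)\<bar>
            = \<bar>2 * pi / L j * (of_int \<lfloor>\<xi> * L j / (2 * pi)\<rfloor> - \<xi> * L j / (2 * pi))\<bar>"
          using L(1)[of j] by (subst abs_mult) simp
        also have "2 * pi / L j * (of_int \<lfloor>\<xi> * L j / (2 * pi)\<rfloor> - \<xi> * L j / (2 * pi)) = q j \<xi> - \<xi>"
          using L(1)[of j] by (simp add: q_def right_diff_distrib)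
        finally show ?thesis .
      qed
      ultimately show ?thesis by simp
    qed
    then show "eventually (\<lambda>j. norm (q j \<xi> - \<xi>) \<le> 2 * pi / L j) sequentially" by simp
    show "(\<lambda>j. 2 * pi / L j) \<longlonglongrightarrow> 0"
      by (rule real_tendsto_divide_at_top[OF tendsto_const L(2)])
  qed
  note [measurable] = borel_measurable_integrable[OF int]
  have [measurable]: "q j \<in> borel_measurable borel" for j unfolding q_def by measurable
  have "(\<lambda>j. LINT \<xi>|lborel. cis (q j \<xi> * y - r * (q j \<xi>)\<^sup>2) * h \<xi>) \<longlonglongrightarrow> (LINT \<xi>|lborel. cis (\<xi> * y - r * \<xi>\<^sup>2) * h \<xi>)"
  proof (rule integral_dominated_convergence[where w = "\<lambda>\<xi>. cmod (h \<xi>)"])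
    show "AE \<xi> in lborel. (\<lambda>j. cis (q j \<xi> * y - r * (q j \<xi>)\<^sup>2) * h \<xi>) \<longlonglongrightarrow> cis (\<xi> * y - r * \<xi>\<^sup>2) * h \<xi>"
    proof (rule AE_I2)
      fix \<xi> :: real
      have "continuous_on UNIV cis" by (intro continuous_intros)
      moreover have "(\<lambda>j. q j \<xi> * y - r * (q j \<xi>)\<^sup>2) \<longlonglongrightarrow> \<xi> * y - r * \<xi>\<^sup>2"
        by (intro tendsto_intros q)
      ultimately have "(\<lambda>j. cis (q j \<xi> * y - r * (q j \<xi>)\<^sup>2)) \<longlonglongrightarrow> cis (\<xi> * y - r * \<xi>\<^sup>2)"
        by (rule continuous_on_tendsto_compose) simp_all
      then show "(\<lambda>j. cis (q j \<xi> * y - r * (q j \<xi>)\<^sup>2) * h \<xi>) \<longlonglongrightarrow> cis (\<xi> * y - r * \<xi>\<^sup>2) * h \<xi>"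
        by (rule tendsto_mult[OF _ tendsto_const])
    qed
  qed (use int in \<open>simp_all add: norm_mult\<close>)
  then have "(\<lambda>j. (LINT \<xi>|lborel. cis (q j \<xi> * y - r * (q j \<xi>)\<^sup>2) * h \<xi>) / of_real (2 * pi))
      \<longlonglongrightarrow> (LINT \<xi>|lborel. cis (\<xi> * y - r * \<xi>\<^sup>2) * h \<xi>) / of_real (2 * pi)"
    by (rule tendsto_divide[OF _ tendsto_const]) simp
  moreover have "trig_wave (L j) (K j) (cell_coeff h (L j)) r y
      = (LINT \<xi>|lborel. cis (q j \<xi> * y - r * (q j \<xi>)\<^sup>2) * h \<xi>) / of_real (2 * pi)" for j
    unfolding q_def by (rule trig_wave_cell_coeff[OF int K supp])
  moreover have "cis (\<xi> * y - r * \<xi>\<^sup>2) * h \<xi> = cis (\<xi> * y) * (cis (- (r * \<xi>\<^sup>2)) * h \<xi>)" for \<xi>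
    unfolding mult.assoc[symmetric] cis_mult by simp
  ultimately show ?thesis by (simp add: free_wave_def fourier_int_def)
qed

text \<open>The phases \<open>cis (- (pi * of_int k))\<close> translate the wave by half a period.
  The domain thereby becomes an interval centred at 0, which grows to the whole line, whereas
  \<open>{0..<L}\<close> would only reach a half-line.\<close>

lemma L4_norm4_trig_wave_shift:
  assumes L: "L > 0"
  shows "L4_norm4 (torus_measure L) (trig_wave L K (\<lambda>k. a k * cis (- (pi * of_int k))) r)
    = (\<integral>\<^sup>+ y\<in>{- (L/2)..<L/2}. ennreal ((cmod (trig_wave L K a r y)) ^ 4) \<partial>lborel)"
proof -
  have [measurable]: "trig_wave L K a r \<in> borel_measurable borel"
    unfolding trig_wave_def[abs_def] by measurable
  have shift: "trig_wave L K (\<lambda>k. a k * cis (- (pi * of_int k))) r x = trig_wave L K a r (x - L/2)" for x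
    unfolding trig_wave_def
  proof (rule sum.cong[OF refl])
    fix k
    have "cis (2 * pi * of_int k / L * (x - L/2)) = cis (- (pi * of_int k)) * cis (2 * pi * of_int k / L * x)"
    proof -
      have "2 * pi * of_int k / L * (x - L/2) = - (pi * of_int k) + 2 * pi * of_int k / L * x"
        using L by (simp add: field_simps)
      then show ?thesis by (simp only: cis_mult)
    qed
    then show "cis (- (r * (2 * pi * of_int k / L)\<^sup>2)) * (a k * cis (- (pi * of_int k))) * cis (2 * pi * of_int k / L * x)
      = cis (- (r * (2 * pi * of_int k / L)\<^sup>2)) * a k * cis (2 * pi * of_int k / L * (x - L/2))"
      by (simp only: mult_ac)
  qed
  have "L4_norm4 (torus_measure L) (trig_wave L K (\<lambda>k. a k * cis (- (pi * of_int k))) r)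
      = (\<integral>\<^sup>+ x. ennreal ((cmod (trig_wave L K a r (x - L/2))) ^ 4) * indicator {0..<L} x \<partial>lborel)"
    unfolding L4_norm4_def torus_measure_def shift by (rule nn_integral_restrict_space) simp
  also have "\<dots> = (\<integral>\<^sup>+ y. ennreal ((cmod (trig_wave L K a r y)) ^ 4) * indicator {0..<L} (y + L/2) \<partial>lborel)"
    by (subst nn_integral_real_affine[where c = 1 and t = "L/2"]) (simp_all add: add.commute)
  also have "\<dots> = (\<integral>\<^sup>+ y\<in>{- (L/2)..<L/2}. ennreal ((cmod (trig_wave L K a r y)) ^ 4) \<partial>lborel)"
    by (rule nn_integral_cong) (auto split: split_indicator)
  finally show ?thesis .
qed

lemma free_wave_L4_le_liminf:
  assumes h: "h \<in> L2_space lborel" and norm: "L2_norm_sq lborel h \<le> ennreal (2 * pi)"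
    and supp: "\<And>\<xi>. \<bar>\<xi>\<bar> > real N \<Longrightarrow> h \<xi> = 0"
    and L: "\<And>j. L j > 0" "filterlim L at_top sequentially"
  shows "(\<integral>\<^sup>+ r\<in>{0..1}. L4_norm4 lborel (free_wave h r) \<partial>lborel) \<le> liminf (\<lambda>j. omega1 (L j))"
proof -
  \<comment> \<open>Because \<open>2 * pi\<close> exceeds 1, frequencies of modulus at most
    \<open>N\<close> have cell indices controlled by \<open>real N * L j\<close>, so
    \<open>K j\<close> contains every cell that meets the support of \<open>h\<close>.\<close>
  define M where "M j = nat \<lceil>real N * L j\<rceil> + 1" for j
  define K where "K j = {-int (M j)..int (M j)}" for j
  have K: "finite (K j)" for j by (simp add: K_def)
  have int: "integrable lborel h"
    by (rule integrable_of_L2_bounded_support[OF h, of "- (real N + 1)" "real N + 1"]) (auto intro!: supp)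
  have supp': "\<lfloor>\<xi> * L j / (2 * pi)\<rfloor> \<in> K j" if "h \<xi> \<noteq> 0" for j \<xi>
  proof -
    have \<xi>: "\<bar>\<xi>\<bar> \<le> real N" using supp that by force
    have "\<bar>\<xi> * L j / (2 * pi)\<bar> = \<bar>\<xi>\<bar> * L j / (2 * pi)" using L(1)[of j] by (simp add: abs_mult)
    also have "\<dots> \<le> \<bar>\<xi>\<bar> * L j / 1"
      using L(1)[of j] pi_gt3 by (intro divide_left_mono) auto
    also have "\<dots> \<le> real N * L j" using \<xi> L(1)[of j] by simp
    finally have "\<bar>\<xi> * L j / (2 * pi)\<bar> \<le> real N * L j" .
    moreover have "real N * L j + 1 \<le> real (M j)" unfolding M_def by linarith
    ultimately have "- real (M j) \<le> \<xi> * L j / (2 * pi)" "\<xi> * L j / (2 * pi) < real (M j) + 1"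
      by linarith+
    then show ?thesis by (simp add: K_def le_floor_iff floor_le_iff)
  qed
  define a where "a j = cell_coeff h (L j)" for j
  \<comment> \<open>The indicator of the centred period extends the torus integrand by 0 to the
    whole line, so that Fatou's lemma works on a fixed measure space.\<close>
  define F where "F j r y = ennreal ((cmod (trig_wave (L j) (K j) (a j) r y)) ^ 4) * indicator {- (L j / 2)..<L j / 2} y" for j r y
  have [measurable]: "(\<lambda>(r, y). F j r y) \<in> borel_measurable (borel \<Otimes>\<^sub>M borel)" for j
    unfolding F_def by measurable
  have Fm [measurable]: "F j r \<in> borel_measurable borel" for j r
    unfolding F_def[abs_def] trig_wave_def by measurable
  have le: "(\<integral>\<^sup>+ r\<in>{0..1}. (\<integral>\<^sup>+ y. F j r y \<partial>lborel) \<partial>lborel) \<le> omega1 (L j)" for j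
  proof -
    \<comment> \<open>The recentring phases are unimodular and leave the norm of the coefficients
      unchanged.\<close>
    have "L j * (\<Sum>k\<in>K j. (cmod (a j k * cis (- (pi * of_int k))))\<^sup>2) \<le> 1"
      using sum_cell_coeff_sq_le[OF h int L(1) norm K supp'] by (simp add: a_def norm_mult)
    then show ?thesis
      using trig_wave_L4_le_omega1[OF L(1), where b = "\<lambda>k. a j k * cis (- (pi * of_int k))"]
      unfolding K_def L4_norm4_trig_wave_shift[OF L(1)] F_def by simp
  qed
  have F_lim: "(\<lambda>j. F j r y) \<longlonglongrightarrow> ennreal ((cmod (free_wave h r y)) ^ 4)" for r y
  proof (rule Lim_transform_eventually)
    show "(\<lambda>j. ennreal ((cmod (trig_wave (L j) (K j) (a j) r y)) ^ 4)) \<longlonglongrightarrow> ennreal ((cmod (free_wave h r y)) ^ 4)"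
      unfolding a_def by (intro tendsto_ennrealI tendsto_intros trig_wave_cell_coeff_tendsto int L K supp')
    \<comment> \<open>From here on \<open>y\<close> lies in the centred period and the indicator
      equals 1.\<close>
    have "eventually (\<lambda>j. L j > 2 * \<bar>y\<bar>) sequentially"
      using L(2) by (rule filterlim_at_top_dense[THEN iffD1, rule_format])
    then show "eventually (\<lambda>j. ennreal ((cmod (trig_wave (L j) (K j) (a j) r y)) ^ 4) = F j r y) sequentially"
      by eventually_elim (auto simp: F_def indicator_def)
  qed
  have "(\<integral>\<^sup>+ r\<in>{0..1}. L4_norm4 lborel (free_wave h r) \<partial>lborel)
      = (\<integral>\<^sup>+ r\<in>{0..1}. (\<integral>\<^sup>+ y. liminf (\<lambda>j. F j r y) \<partial>lborel) \<partial>lborel)"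
    unfolding L4_norm4_def using lim_imp_Liminf[OF sequentially_bot F_lim] by simp
  also have "\<dots> \<le> (\<integral>\<^sup>+ r. liminf (\<lambda>j. (\<integral>\<^sup>+ y. F j r y \<partial>lborel) * indicator {0..1} r) \<partial>lborel)"
  proof (rule nn_integral_mono)
    fix r :: real
    have "(\<integral>\<^sup>+ y. liminf (\<lambda>j. F j r y) \<partial>lborel) \<le> liminf (\<lambda>j. \<integral>\<^sup>+ y. F j r y \<partial>lborel)"
      by (rule nn_integral_liminf) simp
    then show "(\<integral>\<^sup>+ y. liminf (\<lambda>j. F j r y) \<partial>lborel) * indicator {0..1} r
        \<le> liminf (\<lambda>j. (\<integral>\<^sup>+ y. F j r y \<partial>lborel) * indicator {0..1} r)"
      by (auto split: split_indicator)
  qed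
  also have "\<dots> \<le> liminf (\<lambda>j. \<integral>\<^sup>+ r\<in>{0..1}. (\<integral>\<^sup>+ y. F j r y \<partial>lborel) \<partial>lborel)"
    by (rule nn_integral_liminf) measurable
  also have "\<dots> \<le> liminf (\<lambda>j. omega1 (L j))"
    by (rule Liminf_mono) (simp add: le)
  finally show ?thesis .
qed

text \<open>This reduces a real parameter to sequences, for which the convergence theorems are used.
  If the bound failed, some \<open>y < C\<close> would admit lengths \<open>L j\<close> of at least
  \<open>Suc j\<close>, hence positive and unbounded, with \<open>f (L j) \<le> y\<close>.\<close>

lemma le_Liminf_at_top_of_sequences:
  fixes f :: "real \<Rightarrow> ennreal"
  assumes "\<And>L. (\<And>j::nat. L j > 0) \<Longrightarrow> filterlim L at_top sequentially \<Longrightarrow> C \<le> liminf (\<lambda>j. f (L j))"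
  shows "C \<le> Liminf at_top f"
  unfolding le_Liminf_iff
proof (intro allI impI, rule ccontr)
  fix y assume y: "y < C" and "\<not> eventually (\<lambda>x. y < f x) at_top"
  then have "\<forall>j::nat. \<exists>x. x \<ge> real (Suc j) \<and> f x \<le> y"
    by (auto simp: eventually_at_top_linorder not_less)
  then obtain L where L: "\<And>j. L j \<ge> real (Suc j)" "\<And>j. f (L j) \<le> y" by metis
  have "filterlim L at_top sequentially"
    using filterlim_real_sequentially
    by (rule filterlim_at_top_mono) (intro always_eventually allI order_trans[OF _ L(1)], simp)
  moreover have "L j > 0" for j using L(1)[of j] by simp
  ultimately have "C \<le> liminf (\<lambda>j. f (L j))" by (intro assms)
  also have "\<dots> \<le> liminf (\<lambda>j::nat. y)" by (rule Liminf_mono) (simp add: L)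
  finally show False using y by (simp add: Liminf_const)
qed

lemma omega1_star_le_Liminf: "omega1_star \<le> Liminf at_top omega1"
  unfolding omega1_star_def
proof (rule SUP_least)
  fix \<phi> assume "\<phi> \<in> {\<phi> \<in> L2_space lborel. L2_norm_sq lborel \<phi> = 1}"
  then have \<phi>: "\<phi> \<in> L2_space lborel" "L2_norm_sq lborel \<phi> = 1" by auto
  let ?h = "fourier_L2 \<phi>"
  \<comment> \<open>Plancherel with a normalised \<open>\<phi>\<close> yields the constant
    \<open>2 * pi\<close>, uniformly in the later truncation \<open>N\<close>.\<close>
  have h: "?h \<in> L2_space lborel" "L2_norm_sq lborel ?h \<le> ennreal (2 * pi)"
    using fourier_L2_props(1,3)[OF \<phi>(1)] \<phi>(2) by auto
  have le: "(\<integral>\<^sup>+ r\<in>{0..1}. L4_norm4 lborel (free_wave (cutoff N ?h) r) \<partial>lborel) \<le> Liminf at_top omega1" for N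
  proof (rule le_Liminf_at_top_of_sequences, rule free_wave_L4_le_liminf)
    show "L2_norm_sq lborel (cutoff N ?h) \<le> ennreal (2 * pi)"
      using cutoff_in_L2(2)[OF h(1)] h(2) by (rule order_trans)
    show "cutoff N ?h \<xi> = 0" if "\<bar>\<xi>\<bar> > real N" for \<xi>
      using that by (auto simp: cutoff_def indicator_def)
  qed (simp_all add: cutoff_in_L2 h)
  have "(\<integral>\<^sup>+ r\<in>{0..1}. L4_norm4 lborel (schrodinger_line r \<phi>) \<partial>lborel)
    \<le> liminf (\<lambda>N. \<integral>\<^sup>+ r\<in>{0..1}. L4_norm4 lborel (free_wave (cutoff N ?h) r) \<partial>lborel)"
    by (rule schrodinger_line_L4_le_liminf[OF \<phi>(1)])
  also have "\<dots> \<le> liminf (\<lambda>N::nat. Liminf at_top omega1)"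
    by (rule Liminf_mono) (simp add: le)
  finally show "(\<integral>\<^sup>+ r\<in>{0..1}. (\<integral>\<^sup>+ x. ennreal ((cmod (schrodinger_line r \<phi> x)) ^ 4) \<partial>lborel) \<partial>lborel) \<le> Liminf at_top omega1"
    by (simp add: L4_norm4_def Liminf_const)
qed

section \<open>Positivity\<close>

lemma fourier_int_cutoff_tendsto:
  assumes int: "integrable lborel \<phi>"
  shows "(\<lambda>N. fourier_int (cutoff N \<phi>) \<xi>) \<longlonglongrightarrow> fourier_int \<phi> \<xi>"
  unfolding fourier_int_def
proof (rule integral_dominated_convergence[where w = "\<lambda>x. cmod (\<phi> x)"])
  note [measurable] = borel_measurable_integrable[OF int]
  show "(\<lambda>x. cis (x * \<xi>) * \<phi> x) \<in> borel_measurable lborel"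
    and "(\<lambda>x. cis (x * \<xi>) * cutoff N \<phi> x) \<in> borel_measurable lborel" for N
    unfolding cutoff_def by measurable
  show "AE x in lborel. norm (cis (x * \<xi>) * cutoff N \<phi> x) \<le> cmod (\<phi> x)" for N
    by (auto simp: cutoff_def indicator_def norm_mult)
  show "AE x in lborel. (\<lambda>N. cis (x * \<xi>) * cutoff N \<phi> x) \<longlonglongrightarrow> cis (x * \<xi>) * \<phi> x"
  proof (rule AE_I2)
    fix x :: real
    have "eventually (\<lambda>N. real N > \<bar>x\<bar>) sequentially"
      using filterlim_real_sequentially by (rule filterlim_at_top_dense[THEN iffD1, rule_format])
    then have "eventually (\<lambda>N. cis (x * \<xi>) * cutoff N \<phi> x = cis (x * \<xi>) * \<phi> x) sequentially"
      by eventually_elim (auto simp: cutoff_def indicator_def)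
    then show "(\<lambda>N. cis (x * \<xi>) * cutoff N \<phi> x) \<longlonglongrightarrow> cis (x * \<xi>) * \<phi> x"
      by (rule tendsto_eventually)
  qed
qed (use int in simp)

lemma fourier_L2_AE_eq:
  assumes \<phi>: "\<phi> \<in> L2_space lborel" and int: "integrable lborel \<phi>"
  shows "AE \<xi> in lborel. fourier_L2 \<phi> \<xi> = fourier_int \<phi> (- \<xi>)"
proof (rule L2_tendsto_AE_eq[OF _ L2_spaceD(1)[OF fourier_L2_props(1)[OF \<phi>]] fourier_L2_props(2)[OF \<phi>]])
  have [measurable]: "cutoff N \<phi> \<in> borel_measurable borel" for N
    using cutoff_in_L2(1)[OF \<phi>, THEN L2_spaceD(1)] by simp
  show "(\<lambda>\<xi>. fourier_int (cutoff N \<phi>) (- \<xi>)) \<in> borel_measurable lborel" for N by measurable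
qed (rule fourier_int_cutoff_tendsto[OF int])

text \<open>An integrable profile \<open>\<gamma>\<close> makes the truncated waves converge at
  every point. Replacing the chosen transform by \<open>\<gamma>\<close> changes no integral, so
  uniqueness of limits identifies the evolution with an honest integral.\<close>

lemma schrodinger_line_AE_eq:
  assumes \<phi>: "\<phi> \<in> L2_space lborel" and \<gamma>: "integrable lborel \<gamma>"
    and ae: "AE \<xi> in lborel. fourier_L2 \<phi> \<xi> = \<gamma> \<xi>"
  shows "AE x in lborel. schrodinger_line r \<phi> x = free_wave \<gamma> r x"
proof (rule L2_tendsto_AE_eq[OF _ schrodinger_line_props[OF \<phi>]])
  let ?h = "fourier_L2 \<phi>"
  note [measurable] = borel_measurable_integrable[OF \<gamma>]
  have h: "?h \<in> L2_space lborel" by (rule fourier_L2_props(1)[OF \<phi>])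
  have [measurable]: "?h \<in> borel_measurable borel" using L2_spaceD(1)[OF h] by simp
  have [measurable]: "cutoff N ?h \<in> borel_measurable borel" for N
    using cutoff_in_L2(1)[OF h, THEN L2_spaceD(1)] by simp
  show "free_wave (cutoff N ?h) r \<in> borel_measurable lborel" for N
    using measurable_compose[OF measurable_Pair1'[of r borel borel] measurable_free_wave] by simp
  have cut: "free_wave (cutoff N ?h) r x = fourier_int (cutoff N (\<lambda>\<xi>. cis (- (r * \<xi>\<^sup>2)) * \<gamma> \<xi>)) x / of_real (2 * pi)" for N x
  proof -
    have "fourier_int (\<lambda>\<xi>. cis (- (r * \<xi>\<^sup>2)) * cutoff N ?h \<xi>) x = fourier_int (cutoff N (\<lambda>\<xi>. cis (- (r * \<xi>\<^sup>2)) * \<gamma> \<xi>)) x"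
      unfolding fourier_int_def cutoff_def
      by (rule integral_cong_AE) (measurable, use ae in eventually_elim, simp)
    then show ?thesis by (simp add: free_wave_def)
  qed
  show "(\<lambda>N. free_wave (cutoff N ?h) r x) \<longlonglongrightarrow> free_wave \<gamma> r x" for x
    unfolding cut unfolding free_wave_def
    by (intro tendsto_divide tendsto_const fourier_int_cutoff_tendsto integrable_cis_mult \<gamma>) simp_all
qed

text \<open>The left side is the characteristic function of the standard normal
  distribution.\<close>

lemma fourier_int_std_normal:
  "fourier_int (\<lambda>x. of_real (std_normal_density x)) \<xi> = of_real (exp (- \<xi>\<^sup>2 / 2))"
proof -
  have "char std_normal_distribution \<xi> = (LINT x|lborel. std_normal_density x *\<^sub>R iexp (\<xi> * x))"
    unfolding char_def by (rule integral_density) (simp_all add: normal_density_nonneg)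
  also have "\<dots> = fourier_int (\<lambda>x. of_real (std_normal_density x)) \<xi>"
    unfolding fourier_int_def
    by (rule Bochner_Integration.integral_cong[OF refl]) (simp add: cis_conv_exp scaleR_conv_of_real mult_ac)
  finally show ?thesis by (simp add: char_std_normal_distribution)
qed

lemma cmod_cis_minus_one_le: "cmod (cis \<theta> - 1) \<le> \<bar>\<theta>\<bar>"
  using iexp_approx1[of \<theta> 0] by (simp add: cis_conv_exp)

text \<open>Without the phase the integral is the total mass 1. The phase changes it by at most
  \<open>\<bar>x\<bar>\<close> times the first absolute moment \<open>sqrt (2/pi)\<close> plus
  \<open>\<bar>r\<bar>\<close> times the second moment 1, which is at most 1/2 in the given
  range.\<close>

lemma fourier_int_modulated_std_normal_ge:
  assumes x: "\<bar>x\<bar> \<le> 1/4" and r: "\<bar>r\<bar> \<le> 1/4"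
  shows "cmod (fourier_int (\<lambda>\<xi>. cis (- (r * \<xi>\<^sup>2)) * of_real (std_normal_density \<xi>)) x) \<ge> 1/2"
proof -
  let ?\<rho> = std_normal_density
  let ?\<theta> = "\<lambda>\<xi>. \<xi> * x - r * \<xi>\<^sup>2"
  have int: "integrable lborel (\<lambda>\<xi>. complex_of_real (?\<rho> \<xi>))" by simp
  have int': "integrable lborel (\<lambda>\<xi>. cis (?\<theta> \<xi>) * complex_of_real (?\<rho> \<xi>))"
    by (rule integrable_cis_mult[OF _ int]) measurable
  have m1: "has_bochner_integral lborel (\<lambda>\<xi>. ?\<rho> \<xi> * \<bar>\<xi>\<bar>) (sqrt (2/pi))"
    using std_normal_moment_abs_odd[of 0] by simp
  have m2: "has_bochner_integral lborel (\<lambda>\<xi>. ?\<rho> \<xi> * \<xi>\<^sup>2) 1"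
    using std_normal_moment_even[of 1] by simp
  have m: "has_bochner_integral lborel (\<lambda>\<xi>. \<bar>x\<bar> * (?\<rho> \<xi> * \<bar>\<xi>\<bar>) + \<bar>r\<bar> * (?\<rho> \<xi> * \<xi>\<^sup>2)) (\<bar>x\<bar> * sqrt (2/pi) + \<bar>r\<bar> * 1)"
    by (intro has_bochner_integral_add has_bochner_integral_mult_right m1 m2)
  have diff: "(LINT \<xi>|lborel. cis (?\<theta> \<xi>) * complex_of_real (?\<rho> \<xi>)) - 1
      = (LINT \<xi>|lborel. cis (?\<theta> \<xi>) * complex_of_real (?\<rho> \<xi>) - complex_of_real (?\<rho> \<xi>))"
    by (subst Bochner_Integration.integral_diff[OF int' int]) simp
  have "cmod ((LINT \<xi>|lborel. cis (?\<theta> \<xi>) * complex_of_real (?\<rho> \<xi>)) - 1)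
      \<le> (LINT \<xi>|lborel. \<bar>x\<bar> * (?\<rho> \<xi> * \<bar>\<xi>\<bar>) + \<bar>r\<bar> * (?\<rho> \<xi> * \<xi>\<^sup>2))"
    unfolding diff
  proof (rule Bochner_Integration.integral_norm_bound_integral)
    show "integrable lborel (\<lambda>\<xi>. \<bar>x\<bar> * (?\<rho> \<xi> * \<bar>\<xi>\<bar>) + \<bar>r\<bar> * (?\<rho> \<xi> * \<xi>\<^sup>2))"
      using m by (rule integrable.intros)
    show "integrable lborel (\<lambda>\<xi>. cis (?\<theta> \<xi>) * complex_of_real (?\<rho> \<xi>) - complex_of_real (?\<rho> \<xi>))"
      by (rule Bochner_Integration.integrable_diff[OF int' int])
    fix \<xi> :: real
    have "cis (?\<theta> \<xi>) * complex_of_real (?\<rho> \<xi>) - complex_of_real (?\<rho> \<xi>) = (cis (?\<theta> \<xi>) - 1) * of_real (?\<rho> \<xi>)"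
      by (simp add: left_diff_distrib)
    then have "norm (cis (?\<theta> \<xi>) * complex_of_real (?\<rho> \<xi>) - complex_of_real (?\<rho> \<xi>)) = cmod (cis (?\<theta> \<xi>) - 1) * ?\<rho> \<xi>"
      by (simp add: norm_mult normal_density_nonneg)
    also have "\<dots> \<le> (\<bar>x\<bar> * \<bar>\<xi>\<bar> + \<bar>r\<bar> * \<xi>\<^sup>2) * ?\<rho> \<xi>"
    proof (rule mult_right_mono)
      have "\<bar>?\<theta> \<xi>\<bar> \<le> \<bar>x\<bar> * \<bar>\<xi>\<bar> + \<bar>r\<bar> * \<xi>\<^sup>2"
        using abs_triangle_ineq4[of "\<xi> * x" "r * \<xi>\<^sup>2"] by (simp add: abs_mult mult.commute)
      then show "cmod (cis (?\<theta> \<xi>) - 1) \<le> \<bar>x\<bar> * \<bar>\<xi>\<bar> + \<bar>r\<bar> * \<xi>\<^sup>2"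
        using cmod_cis_minus_one_le by (rule order_trans[rotated])
    qed (simp add: normal_density_nonneg)
    finally show "norm (cis (?\<theta> \<xi>) * complex_of_real (?\<rho> \<xi>) - complex_of_real (?\<rho> \<xi>))
        \<le> \<bar>x\<bar> * (?\<rho> \<xi> * \<bar>\<xi>\<bar>) + \<bar>r\<bar> * (?\<rho> \<xi> * \<xi>\<^sup>2)"
      by (simp add: algebra_simps)
  qed
  also have "\<dots> = \<bar>x\<bar> * sqrt (2/pi) + \<bar>r\<bar>"
    using has_bochner_integral_integral_eq[OF m] by (simp only: mult_1_right)
  also have "\<dots> \<le> 1/4 * 1 + 1/4"
  proof (rule add_mono[OF mult_mono[OF x] r])
    show "sqrt (2/pi) \<le> 1" using pi_gt3 by simp
  qed simp_all
  finally have "cmod ((LINT \<xi>|lborel. cis (?\<theta> \<xi>) * complex_of_real (?\<rho> \<xi>)) - 1) \<le> 1/2" by simp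
  then have "cmod (LINT \<xi>|lborel. cis (?\<theta> \<xi>) * complex_of_real (?\<rho> \<xi>)) \<ge> 1/2"
    using norm_triangle_ineq3[of "LINT \<xi>|lborel. cis (?\<theta> \<xi>) * complex_of_real (?\<rho> \<xi>)" 1] by simp
  moreover have "cis (?\<theta> \<xi>) * complex_of_real (?\<rho> \<xi>) = cis (\<xi> * x) * (cis (- (r * \<xi>\<^sup>2)) * of_real (?\<rho> \<xi>))" for \<xi>
    unfolding mult.assoc[symmetric] cis_mult by simp
  ultimately show ?thesis by (simp add: fourier_int_def)
qed

lemma omega1_star_pos: "omega1_star > 0"
proof -
  \<comment> \<open>The square of the standard normal density has integral
    \<open>1 / (2 * sqrt pi)\<close>; this \<open>c\<close> normalises it, and the squared modulus
    of \<open>\<phi>\<close> becomes the normal density of variance 1/2.\<close>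
  define c where "c = sqrt (2 * sqrt pi)"
  have c: "c > 0" "c\<^sup>2 = 2 * sqrt pi" by (simp_all add: c_def)
  define \<phi> where "\<phi> x = complex_of_real (c * std_normal_density x)" for x
  have [measurable]: "\<phi> \<in> borel_measurable borel" unfolding \<phi>_def[abs_def] by measurable
  have "(cmod (\<phi> x))\<^sup>2 = normal_density 0 (1 / sqrt 2) x" for x
  proof -
    have "(cmod (\<phi> x))\<^sup>2 = c\<^sup>2 * (exp (- x\<^sup>2 / 2))\<^sup>2 / (2 * pi)"
      unfolding \<phi>_def norm_of_real power2_abs
      by (simp add: std_normal_density_def power_mult_distrib power_divide)
    also have "(exp (- x\<^sup>2 / 2))\<^sup>2 = exp (- x\<^sup>2)"
      by (simp add: power2_eq_square mult_exp_exp)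
    also have "c\<^sup>2 * exp (- x\<^sup>2) / (2 * pi) = exp (- x\<^sup>2) / sqrt pi"
      by (simp add: c(2) field_simps)
    also have "\<dots> = normal_density 0 (1 / sqrt 2) x"
      by (simp add: normal_density_def power_divide)
    finally show ?thesis .
  qed
  then have norm: "L2_norm_sq lborel \<phi> = 1"
    by (simp add: L2_norm_sq_def nn_integral_eq_integral normal_density_nonneg)
  then have \<phi>: "\<phi> \<in> L2_space lborel" by (simp add: L2_space_def)
  have int: "integrable lborel \<phi>" unfolding \<phi>_def by simp
  \<comment> \<open>The transform of the density is \<open>exp (- \<xi>\<^sup>2 / 2)\<close>, that
    is \<open>sqrt (2 * pi)\<close> times the density itself.\<close>
  define d where "d = c * sqrt (2 * pi)"
  have d: "d > 0" using c by (simp add: d_def)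
  define \<gamma> where "\<gamma> \<xi> = of_real d * complex_of_real (std_normal_density \<xi>)" for \<xi>
  have \<gamma>: "integrable lborel \<gamma>" unfolding \<gamma>_def by simp
  have "fourier_int \<phi> (- \<xi>) = \<gamma> \<xi>" for \<xi>
  proof -
    have "fourier_int \<phi> (- \<xi>) = of_real c * fourier_int (\<lambda>x. of_real (std_normal_density x)) (- \<xi>)"
      unfolding fourier_int_def \<phi>_def by (subst integral_mult_right_zero[symmetric]) (simp add: mult_ac)
    then show ?thesis
      unfolding fourier_int_std_normal by (simp add: \<gamma>_def d_def std_normal_density_def)
  qed
  then have wave: "AE x in lborel. schrodinger_line r \<phi> x = free_wave \<gamma> r x" for r
    using fourier_L2_AE_eq[OF \<phi> int] by (intro schrodinger_line_AE_eq[OF \<phi> \<gamma>]) simp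
  \<comment> \<open>The lower bound 1/2 for the modulated integral, multiplied by \<open>d\<close>
    and divided by \<open>2 * pi\<close>, is \<open>d / (4 * pi)\<close>.\<close>
  define e where "e = (d / (4 * pi)) ^ 4"
  have e: "e > 0" using d by (simp add: e_def)
  have lower: "(cmod (free_wave \<gamma> r x)) ^ 4 \<ge> e" if "\<bar>x\<bar> \<le> 1/4" "\<bar>r\<bar> \<le> 1/4" for r x
  proof -
    have "free_wave \<gamma> r x = of_real d * fourier_int (\<lambda>\<xi>. cis (- (r * \<xi>\<^sup>2)) * of_real (std_normal_density \<xi>)) x / of_real (2 * pi)"
      unfolding free_wave_def fourier_int_def \<gamma>_def by (subst integral_mult_right_zero[symmetric]) (simp add: mult_ac)
    then have "cmod (free_wave \<gamma> r x) = d * cmod (fourier_int (\<lambda>\<xi>. cis (- (r * \<xi>\<^sup>2)) * of_real (std_normal_density \<xi>)) x) / (2 * pi)"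
      using d by (simp add: norm_mult norm_divide)
    also have "\<dots> \<ge> d * (1/2) / (2 * pi)"
      using d by (intro divide_right_mono mult_left_mono fourier_int_modulated_std_normal_ge that) simp_all
    finally show ?thesis unfolding e_def using d by (intro power_mono) simp_all
  qed
  \<comment> \<open>The factor \<open>e / 2\<close> is \<open>e\<close> times the length 1/2 of the
    interval in \<open>x\<close>, and 1/4 is the length of the time interval.\<close>
  have "0 < ennreal (e / 2) * ennreal (1/4)" using e by (simp add: ennreal_mult'[symmetric])
  also have "\<dots> = (\<integral>\<^sup>+ r. ennreal (e / 2) * indicator {0..1/4::real} r \<partial>lborel)"
    by (subst nn_integral_cmult_indicator) simp_all
  also have "\<dots> \<le> (\<integral>\<^sup>+ r\<in>{0..1}. (\<integral>\<^sup>+ x. ennreal ((cmod (schrodinger_line r \<phi> x)) ^ 4) \<partial>lborel) \<partial>lborel)"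
  proof (rule nn_integral_mono)
    fix r :: real
    show "ennreal (e / 2) * indicator {0..1/4} r \<le> (\<integral>\<^sup>+ x. ennreal ((cmod (schrodinger_line r \<phi> x)) ^ 4) \<partial>lborel) * indicator {0..1} r"
    proof (cases "r \<in> {0..1/4}")
      case True
      have "ennreal (e / 2) = ennreal e * ennreal (1/2)" using e by (subst ennreal_mult'[symmetric]) simp_all
      also have "\<dots> = (\<integral>\<^sup>+ x. ennreal e * indicator {-(1/4)..1/4::real} x \<partial>lborel)"
        by (subst nn_integral_cmult_indicator) simp_all
      also have "\<dots> \<le> (\<integral>\<^sup>+ x. ennreal ((cmod (free_wave \<gamma> r x)) ^ 4) \<partial>lborel)"
        by (rule nn_integral_mono) (use True lower in \<open>auto split: split_indicator intro!: ennreal_leI\<close>)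
      also have "\<dots> = (\<integral>\<^sup>+ x. ennreal ((cmod (schrodinger_line r \<phi> x)) ^ 4) \<partial>lborel)"
        by (rule nn_integral_cong_AE, use wave[of r] in eventually_elim) simp
      finally show ?thesis using True by simp
    qed simp
  qed
  also have "\<dots> \<le> omega1_star"
    unfolding omega1_star_def by (rule SUP_upper) (simp add: \<phi> norm)
  finally show ?thesis .
qed

theorem proposition5p1:
  "Liminf at_top (\<lambda>L::real. omega1 L) \<ge> omega1_star \<and> omega1_star > 0"
  using omega1_star_le_Liminf omega1_star_pos by simp

end
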